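(* Let $C$ be a cycle of goods and $N$ a set of agents of at most three types. Then there exists a $\frac34$-sufficient allocation of the goods of $C$ to the agents in $N$.
   Context: A cycle of goods has goods $v_1,\dots,v_m$ with edges $v_iv_{i+1}$ and $v_mv_1$. A utility function assigns a non-negative real to each good, extended additively to sets. A bundle is a set of goods inducing a connected subgraph (empty allowed); an $n$-split is a sequence of $n$ pairwise disjoint bundles (possibly empty) with union all goods. $\mathrm{mms}^{(n)}(C,u)=\max_{P_1,\dots,P_n}\min_i u(P_i)$ over all $n$-splits. Agents are of the same type if they have the same utility function. An allocation to agents $1,\dots,n$ with utilities $u_1,\dots,u_n$ is an $n$-split $P_1,\dots,P_n$ with $P_i$ given to agent $i$; for $c>0$ it is $c$-sufficient if $u_i(P_i)\ge c\cdot\mathrm{mms}^{(n)}(C,u_i)$ for all $i$. *)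

theory Defs
  imports Complex_Main
begin

definition cycle_adj :: "nat \<Rightarrow> nat \<Rightarrow> nat \<Rightarrow> bool" where
  "cycle_adj m i j \<longleftrightarrow> i < m \<and> j < m \<and> (j = Suc i mod m \<or> i = Suc j mod m)"

text \<open>A bundle: a set of goods inducing a connected subgraph of the cycle (empty allowed).\<close>
definition is_bundle :: "nat \<Rightarrow> nat set \<Rightarrow> bool" where
  "is_bundle m S \<longleftrightarrow> S \<subseteq> {..<m} \<and>
     (\<forall>x\<in>S. \<forall>y\<in>S. (\<lambda>a b. a \<in> S \<and> b \<in> S \<and> cycle_adj m a b)\<^sup>*\<^sup>* x y)"

definition is_split :: "nat \<Rightarrow> nat \<Rightarrow> (nat \<Rightarrow> nat set) \<Rightarrow> bool" where
  "is_split m n P \<longleftrightarrow> (\<forall>i<n. is_bundle m (P i)) \<and>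
     (\<forall>i<n. \<forall>j<n. i \<noteq> j \<longrightarrow> P i \<inter> P j = {}) \<and>
     (\<Union>i<n. P i) = {..<m}"

definition util :: "(nat \<Rightarrow> real) \<Rightarrow> nat set \<Rightarrow> real" where
  "util u S = (\<Sum>g\<in>S. u g)"

text \<open>Maximin share mms^(n)(C,u) (for n \<ge> 1).\<close>
definition mms :: "nat \<Rightarrow> nat \<Rightarrow> (nat \<Rightarrow> real) \<Rightarrow> real" where
  "mms m n u = Max {Min ((\<lambda>i. util u (P i)) ` {..<n}) | P. is_split m n P}"

definition sufficient :: "real \<Rightarrow> nat \<Rightarrow> nat \<Rightarrow> (nat \<Rightarrow> nat \<Rightarrow> real) \<Rightarrow> (nat \<Rightarrow> nat set) \<Rightarrow> bool" where
  "sufficient c m n U P \<longleftrightarrow> is_split m n P \<and> (\<forall>i<n. util (U i) (P i) \<ge> c * mms m n (U i))"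

end

(*
Scale every utility so that its maximin share is 1; each type then has cyclically arranged cut points
with consecutive arcs of value at least 1. Let nA >= nB >= nC be the numbers of agents of the three
types. Bundles are cut off from left to right on a stretch of the unrolled cycle that starts at a
carefully chosen point. A type whose cuts fit the stretch keeps enough arcs all the way; a type T
whose arc is split by the starting point lacks one arc. If T's leftover before its next cut has value
at least d/4 and a piece of value below 3/4 for T is cut off, the new leftover has value at least
(d+1)/4, and at 3/4 the missing arc is recovered. So T fails only if runs of pieces that are bad for T
stay short; then T is served often, and it has too few agents for that.

Suppose that no allocation exists. Step by step, this forces every cut to lie well inside the arcs
of the other types (value above 1/4 on both sides) and the cuts of the three types to alternate.
In the arc system of one type, two consecutive arcs are then never both bad for the same other type.
If nA >= n/2, Hall's condition assigns the arcs of A. Otherwise Hall's condition fails for each of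
the three arc systems, so altogether more than n of the 3n arcs are bad for both other types.
Numbering all cuts consecutively, bad arcs never start at distance 2 or 3, and more than n of them
in a cycle of length 3n cannot avoid distance 5 as well. But two bad arcs at distance 5 yield a piece
that runs from a cut of one type to a cut of a second type, is shorter than an arc, and is worth 1 to
the third type; starting with this piece makes up for the missing arc.
*)
theory Submission
  imports Defs "HOL-Combinatorics.Permutations"
begin

section \<open>Cutting a path from left to right\<close>

text \<open>\<open>F t\<close> gives prefix values, so \<open>F t p' - F t p\<close> is the worth of
  the piece from \<open>p\<close> to \<open>p'\<close> for type \<open>t\<close>. \<open>N t\<close>
  counts the unserved agents of type \<open>t\<close>, and \<open>e\<close> ends the stretch that
  may be cut up.\<close>

inductive deals :: "('a \<Rightarrow> int \<Rightarrow> real) \<Rightarrow> int \<Rightarrow> ('a \<Rightarrow> nat) \<Rightarrow> int \<Rightarrow> bool" for F e where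
  finish: "(\<And>t. N t = 0) \<Longrightarrow> p \<le> e \<Longrightarrow> deals F e N p"
| serve: "N t > 0 \<Longrightarrow> p \<le> p' \<Longrightarrow> F t p + 3/4 \<le> F t p' \<Longrightarrow> deals F e (N(t := N t - 1)) p'
    \<Longrightarrow> deals F e N p"

definition cap :: "(int \<Rightarrow> real) \<Rightarrow> int \<Rightarrow> nat \<Rightarrow> int \<Rightarrow> bool" where
  "cap f e r p \<longleftrightarrow> (\<exists>q. p \<le> q 0 \<and> q r \<le> e \<and> (\<forall>i<r. f (q i) + 3/4 \<le> f (q (Suc i))))"

lemma mono_less_args: "mono (f :: int \<Rightarrow> real) \<Longrightarrow> f x < f y \<Longrightarrow> x < y"
  by (metis linorder_not_less monoD)

lemma chain_le:
  fixes f :: "int \<Rightarrow> real" and q :: "nat \<Rightarrow> int"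
  assumes "mono f" "c > 0" "\<And>i. i < r \<Longrightarrow> f (q i) + c \<le> f (q (Suc i))" "i \<le> j" "j \<le> r"
  shows "q i \<le> q j"
  using assms(4,5)
proof (induction j rule: dec_induct)
  case (step j)
  then have "f (q j) < f (q (Suc j))" using assms(2) assms(3)[of j] by auto
  then show ?case using mono_less_args[OF assms(1)] step by fastforce
qed auto

lemma sum_fun_upd_dec:
  fixes N :: "'a::finite \<Rightarrow> nat"
  assumes "N t > 0" "sum N UNIV = Suc r"
  shows "sum (N(t := N t - 1)) UNIV = r"
proof -
  have "sum N UNIV = N t + sum N (UNIV - {t})" by (simp add: sum.remove)
  moreover have "sum (N(t := N t - 1)) UNIV = (N t - 1) + sum (N(t := N t - 1)) (UNIV - {t})"
    by (subst sum.remove[of _ t]) auto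
  moreover have "sum (N(t := N t - 1)) (UNIV - {t}) = sum N (UNIV - {t})"
    by (intro sum.cong) auto
  ultimately show ?thesis using assms by linarith
qed

text \<open>A moving knife: the type whose next cut \<open>q t 1\<close> comes first takes the piece
  up to it. This piece ends no later than the next cut of any other type, so every type gives up
  only one arc per agent served.\<close>

lemma deals_path:
  fixes F :: "'a::finite \<Rightarrow> int \<Rightarrow> real"
  assumes mono: "\<And>t. mono (F t)"
  shows "sum N UNIV = r \<Longrightarrow> p \<le> e \<Longrightarrow> (\<And>t. N t > 0 \<Longrightarrow> cap (F t) e r p) \<Longrightarrow> deals F e N p"
proof (induction r arbitrary: N p)
  case 0
  then show ?case by (intro deals.finish) auto
next
  case (Suc r)
  let ?A = "{t. N t > 0}"
  have ne: "?A \<noteq> {}"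
  proof
    assume "?A = {}"
    then have "\<And>t. N t = 0" by auto
    then show False using Suc.prems(1) by simp
  qed
  let ?Q = "\<lambda>t q. p \<le> q 0 \<and> q (Suc r) \<le> e \<and> (\<forall>i<Suc r. F t (q i) + 3/4 \<le> F t (q (Suc i)))"
  define q where "q t = (SOME q. ?Q t q)" for t
  have Q: "?Q t (q t)" if "N t > 0" for t
    unfolding q_def using Suc.prems(3)[OF that] unfolding cap_def by (rule someI_ex)
  have q: "\<And>t. N t > 0 \<Longrightarrow> p \<le> q t 0" "\<And>t. N t > 0 \<Longrightarrow> q t (Suc r) \<le> e"
    "\<And>t i. N t > 0 \<Longrightarrow> i < Suc r \<Longrightarrow> F t (q t i) + 3/4 \<le> F t (q t (Suc i))"
    using Q by blast+
  obtain t where t: "N t > 0" "\<And>s. N s > 0 \<Longrightarrow> q t 1 \<le> q s 1"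
    using arg_min_if_finite(1)[of ?A "\<lambda>t. q t 1"] arg_min_least[of ?A _ "\<lambda>t. q t 1"] ne by auto
  have le: "q s i \<le> q s j" if "N s > 0" "i \<le> j" "j \<le> Suc r" for s i j
    by (rule chain_le[of "F s" "3/4" "Suc r"]) (use mono q(3)[OF that(1)] that in auto)
  have p1: "p \<le> q t 1" using q(1)[OF t(1)] le[OF t(1), of 0 1] by simp
  have e1: "q t 1 \<le> e" using q(2)[OF t(1)] le[OF t(1), of 1 "Suc r"] by simp
  have v: "F t p + 3/4 \<le> F t (q t 1)"
    using q(3)[OF t(1), of 0] monoD[OF mono, OF q(1)[OF t(1)], of t] by simp
  have "deals F e (N(t := N t - 1)) (q t 1)"
  proof (rule Suc.IH)
    show "sum (N(t := N t - 1)) UNIV = r" using sum_fun_upd_dec[of N t r] t(1) Suc.prems(1) by simp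
    show "q t 1 \<le> e" by fact
    fix s assume "0 < (N(t := N t - 1)) s"
    then have s: "N s > 0" by (auto split: if_splits)
    show "cap (F s) e r (q t 1)"
      unfolding cap_def
      by (intro exI[of _ "\<lambda>i. q s (Suc i)"]) (use t(2)[OF s] q(2,3)[OF s] in auto)
  qed
  then show ?case by (rule deals.serve[where F = F and N = N, OF t(1) p1 v])
qed

lemma first_hit:
  fixes f :: "int \<Rightarrow> real"
  assumes "p \<le> L" "c \<le> f L"
  obtains h where "p \<le> h" "h \<le> L" "c \<le> f h" "\<And>x. p \<le> x \<Longrightarrow> x < h \<Longrightarrow> f x < c"
proof -
  define A where "A = {p..L} \<inter> {x. c \<le> f x}"
  have fin: "finite A" "L \<in> A" using assms by (simp_all add: A_def)
  then have "Min A \<in> A" by (intro Min_in) auto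
  then show ?thesis
  proof (intro that[of "Min A"])
    fix x assume "p \<le> x" "x < Min A"
    show "f x < c"
    proof (rule ccontr)
      assume "\<not> f x < c"
      then have "x \<in> A" using \<open>p \<le> x\<close> \<open>x < Min A\<close> \<open>Min A \<in> A\<close> by (simp add: A_def)
      then show False using Min_le[OF fin(1), of x] \<open>x < Min A\<close> by simp
    qed
  qed (simp_all add: A_def)
qed

text \<open>
  Type \<open>T\<close> lacks one arc: \<open>t\<close> provides only \<open>R - 1\<close> of them, plus a leftover of value at least \<open>d/4\<close> before
  \<open>t 0\<close>; with \<open>d = 3\<close> the leftover counts as an arc. Every piece that is bad for \<open>T\<close> increases \<open>d\<close>,
  and serving \<open>T\<close> resets it to \<open>k\<close>. The last alternative for \<open>w\<close> allows \<open>W\<close> to lack its first arc,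
  provided that its next cut comes after the one of \<open>S\<close>.
\<close>
lemma knife:
  fixes F :: "'a::finite \<Rightarrow> int \<Rightarrow> real"
  assumes mono: "\<And>x. mono (F x)"
    and types: "UNIV = {S, W, T}" "S \<noteq> W" "S \<noteq> T" "W \<noteq> T"
  shows "N S + N W + N T = R \<Longrightarrow> p \<le> e \<Longrightarrow>
    (N S > 0 \<Longrightarrow> p \<le> s 0 \<and> s R \<le> e \<and> (\<forall>i<R. F S (s i) + 3/4 \<le> F S (s (Suc i)))) \<Longrightarrow>
    (N W > 0 \<Longrightarrow> w R \<le> e \<and> (\<forall>i<R. 0 < i \<longrightarrow> F W (w i) + 3/4 \<le> F W (w (Suc i))) \<and>
       (p \<le> w 0 \<and> F W (w 0) + 3/4 \<le> F W (w 1) \<or> N S > 0 \<and> s 1 \<le> w 1)) \<Longrightarrow>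
    (N T > 0 \<Longrightarrow> p \<le> t 0 \<and> t (R - 1) \<le> e \<and> F T p + real d / 4 \<le> F T (t 0) \<and>
       (d \<le> 2 \<and> (\<forall>i<R-1. F T (t i) + 1 \<le> F T (t (Suc i))) \<or>
        d = 3 \<and> (\<forall>i<R-1. F T (t i) + 3/4 \<le> F T (t (Suc i))))) \<Longrightarrow>
    (3 - k) * N T + k + 1 \<le> R + d \<Longrightarrow>
    (k = 0 \<or> k = 1 \<and> (N S > 0 \<longrightarrow> (\<forall>i<R. F T (s i) + 1/4 \<le> F T (t i))) \<and>
       (N T < N S + d \<or> (N W > 0 \<longrightarrow> (\<forall>i<R. F T (w i) + 1/4 \<le> F T (t i))))) \<Longrightarrow>
    deals F e N p"
proof (induction R arbitrary: N p s w t d)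
  case 0
  have "N x = 0" for x using UNIV_I[of x] "0.prems"(1) unfolding types(1) by auto
  then show ?case using 0 by (auto intro: deals.finish)
next
  case (Suc r)
  note NR = Suc.prems(1) and pe = Suc.prems(2) and SS = Suc.prems(3) and WW = Suc.prems(4)
    and TT = Suc.prems(5) and num = Suc.prems(6) and inter = Suc.prems(7)
  have sumN: "sum M UNIV = M S + M W + M T" for M :: "'a \<Rightarrow> nat"
    unfolding types(1) using types(2-4) by simp
  have tys: "x = S \<or> x = W \<or> x = T" for x
    using UNIV_I[of x] unfolding types(1) by simp
  let ?strong = "N W > 0 \<longrightarrow> p \<le> w 0 \<and> F W (w 0) + 3/4 \<le> F W (w 1)"
  have s1: "s 0 < s 1" "s 1 \<le> e" "p \<le> s 1" "F S p + 3/4 \<le> F S (s 1)" if "N S > 0"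
  proof -
    note * = SS[OF that]
    show a: "s 0 < s 1" using mono_less_args[OF mono[of S], of "s 0" "s 1"] * by fastforce
    show "s 1 \<le> e" using chain_le[OF mono[of S], of "3/4" "Suc r" s 1 "Suc r"] * by auto
    show "p \<le> s 1" using a * by auto
    show "F S p + 3/4 \<le> F S (s 1)" using * monoD[OF mono, of p "s 0" S] by fastforce
  qed
  have w1: "w 1 \<le> e" if "N W > 0"
  proof -
    have "(\<lambda>i. w (Suc i)) 0 \<le> (\<lambda>i. w (Suc i)) r"
      by (rule chain_le[OF mono[of W], of "3/4" r]) (use WW[OF that] in auto)
    then show ?thesis using WW[OF that] by auto
  qed
  show ?case
  proof (cases "N T = 0 \<or> d = 3")
    \<comment> \<open>\<open>T\<close> now has as many arcs as there are agents, or no agents at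
      all. Only a missing first arc of \<open>W\<close> can still prevent an application of
      \<open>deals_path\<close>.\<close>
    case cured: True
    show ?thesis
    proof (cases ?strong)
      case True
      show ?thesis
      proof (rule deals_path[OF mono _ pe])
        show "sum N UNIV = Suc r" using NR sumN by simp
        fix x assume x: "N x > 0"
        consider "x = S" | "x = W" | "x = T" using tys by blast
        then show "cap (F x) e (Suc r) p"
        proof cases
          case 1
          then show ?thesis unfolding cap_def by (intro exI[of _ s]) (use SS x in simp)
        next
          case 2
          then have W: "N W > 0" using x by simp
          have "F W (w i) + 3/4 \<le> F W (w (Suc i))" if "i < Suc r" for i
            using True WW[OF W] W that by (cases i) simp_all
          then show ?thesis unfolding cap_def 2 by (intro exI[of _ w]) (use WW[OF W] True W in simp)
        next
          case 3
          then have T: "N T > 0" "d = 3" using x cured by auto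
          have "F T (case_nat p t i) + 3/4 \<le> F T (case_nat p t (Suc i))" if "i < Suc r" for i
            using TT[OF T(1)] T(2) that by (cases i) auto
          then show ?thesis unfolding cap_def 3 using TT[OF T(1)]
            by (intro exI[of _ "case_nat p t"]) auto
        qed
      qed
    next
      case False
      then have w: "N W > 0" "N S > 0" "s 1 \<le> w 1" using WW by auto
      \<comment> \<open>One piece repairs the deficit of \<open>W\<close>: it ends no later than
        \<open>s 1 \<le> w 1\<close>, so the arcs from \<open>w 1\<close> on suffice for the
        remaining agents. \<open>T\<close> takes its leftover up to \<open>t 0\<close> if that ends
        first, otherwise \<open>S\<close> takes the piece.\<close>
      define X p' where "X = (if N T > 0 \<and> t 0 \<le> s 1 then T else S)"
        and "p' = (if N T > 0 \<and> t 0 \<le> s 1 then t 0 else s 1)"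
      have X: "N X > 0" "p \<le> p'" "F X p + 3/4 \<le> F X p'" "p' \<le> s 1" "N T > 0 \<Longrightarrow> p' \<le> t 0"
        using w(2) s1[OF w(2)] TT cured unfolding X_def p'_def by auto
      have "deals F e (N(X := N X - 1)) p'"
      proof (rule deals_path[OF mono])
        show "sum (N(X := N X - 1)) UNIV = r" using X(1) NR sumN sum_fun_upd_dec[of N X r] by simp
        show "p' \<le> e" using X(4) s1[OF w(2)] by simp
        fix x assume "(N(X := N X - 1)) x > 0"
        then have x: "N x > 0" by (auto split: if_splits)
        consider "x = S" | "x = W" | "x = T" using tys by blast
        then show "cap (F x) e r p'"
        proof cases
          case 1
          then show ?thesis unfolding cap_def
            by (intro exI[of _ "\<lambda>i. s (Suc i)"]) (use SS x X(4) in auto)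
        next
          case 2
          then show ?thesis unfolding cap_def
            by (intro exI[of _ "\<lambda>i. w (Suc i)"]) (use WW x X(4) w in auto)
        next
          case 3
          then show ?thesis unfolding cap_def
            by (intro exI[of _ t]) (use TT x X(5) cured in auto)
        qed
      qed
      then show ?thesis by (rule deals.serve[where F = F and N = N, OF X(1-3)])
    qed
  next
    case False
    then have nT: "N T > 0" and dn: "d \<noteq> 3" by auto
    note T = TT[OF nT]
    have d2: "d \<le> 2" and gap: "\<And>i. i < r \<Longrightarrow> F T (t i) + 1 \<le> F T (t (Suc i))" using T dn by auto
    have k: "k = 0 \<or> k = 1" using inter by auto
    \<comment> \<open>The counting hypothesis is an invariant: a bad piece lowers \<open>R\<close>
      and raises \<open>d\<close> by one, and serving \<open>T\<close> lowers \<open>N T\<close> and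
      \<open>R\<close> by one and resets \<open>d\<close> from at most 2 to \<open>k\<close>. While
      \<open>d \<le> 2\<close> it also guarantees a remaining agent of type \<open>S\<close> or
      \<open>W\<close>.\<close>
    have num': "N T + 1 \<le> Suc r" "Suc 0 \<le> r" using k num d2 nT by auto
    \<comment> \<open>\<open>L\<close> is the earlier of the next cuts of \<open>S\<close> and
      \<open>W\<close>, and \<open>X\<close> its owner. A tie goes to \<open>S\<close>, and so does
      the case that \<open>W\<close> lacks its first arc; hence the piece up to \<open>L\<close> is
      worth 3/4 to \<open>X\<close> in every case.\<close>
    define b where "b \<longleftrightarrow> N S > 0 \<and> (N W = 0 \<or> s 1 \<le> w 1)"
    define X L where "X = (if b then S else W)" and "L = (if b then s 1 else w 1)"
    have nb: "N W > 0" "p \<le> w 0" "F W (w 0) + 3/4 \<le> F W (w 1)" "N S > 0 \<longrightarrow> w 1 \<le> s 1" if "\<not> b"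
    proof -
      show "N W > 0" using that num' NR unfolding b_def by auto
      then show "p \<le> w 0" "F W (w 0) + 3/4 \<le> F W (w 1)" "N S > 0 \<longrightarrow> w 1 \<le> s 1"
        using WW that unfolding b_def by auto
    qed
    have w1p: "p \<le> w 1" "F W p + 3/4 \<le> F W (w 1)" if "\<not> b"
    proof -
      have "F W p \<le> F W (w 0)" using nb(2)[OF that] monoD[OF mono] by blast
      then show "F W p + 3/4 \<le> F W (w 1)" using nb(3)[OF that] by simp
      then show "p \<le> w 1" using mono_less_args[OF mono[of W], of p "w 1"] by simp
    qed
    have X: "N X > 0" "p \<le> L" "F X p + 3/4 \<le> F X L" "X \<noteq> T"
      unfolding X_def L_def using w1p nb s1 types unfolding b_def by (auto split: if_splits)
    have L: "N S > 0 \<Longrightarrow> L \<le> s 1" "N W > 0 \<Longrightarrow> L \<le> w 1" "L \<le> e"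
      using nb s1 w1 unfolding L_def b_def by (auto split: if_splits)
    have t01: "t 0 \<le> t 1" "F T (t 0) + 1 \<le> F T (t 1)"
      using gap[of 0] num' mono_less_args[OF mono[of T], of "t 0" "t 1"] by auto
    \<comment> \<open>Any piece that ends by \<open>L\<close> costs each type its first arc. This
      also ends a deficit of \<open>W\<close>, since only the arc from \<open>w 0\<close> to
      \<open>w 1\<close> could be missing.\<close>
    have next_state: "deals F e M p'"
      if M: "M S + M W + M T = r" "M S \<le> N S" "M W \<le> N W" "M T \<le> N T"
        and p': "p' \<le> L" "M T > 0 \<Longrightarrow> p' \<le> t 1" "M T > 0 \<Longrightarrow> F T p' + real d' / 4 \<le> F T (t 1)" "d' \<le> 3"
        and n': "(3 - k) * M T + k + 1 \<le> r + d'" "k = 1 \<Longrightarrow> N T < N S + d \<Longrightarrow> M T < M S + d'" 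
      for M p' d'
    proof (rule Suc.IH[of M p' "\<lambda>i. s (Suc i)" "\<lambda>i. w (Suc i)" "\<lambda>i. t (Suc i)" d'])
      show "M S + M W + M T = r" by fact
      show "p' \<le> e" using p'(1) L by simp
      show "p' \<le> s (Suc 0) \<and> s (Suc r) \<le> e \<and> (\<forall>i<r. F S (s (Suc i)) + 3/4 \<le> F S (s (Suc (Suc i))))"
        if "M S > 0" using that M(2) SS p'(1) L(1) by auto
      show "w (Suc r) \<le> e \<and> (\<forall>i<r. 0 < i \<longrightarrow> F W (w (Suc i)) + 3/4 \<le> F W (w (Suc (Suc i)))) \<and>
        (p' \<le> w (Suc 0) \<and> F W (w (Suc 0)) + 3/4 \<le> F W (w (Suc 1)) \<or> 0 < M S \<and> s (Suc 1) \<le> w (Suc 1))"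
        if "M W > 0" using that M(3) WW p'(1) L(2) num' by auto
      have gap': "\<forall>i<r - 1. F T (t (Suc i)) + 1 \<le> F T (t (Suc (Suc i)))" using gap by auto
      then have gap'': "\<forall>i<r - 1. F T (t (Suc i)) + 3/4 \<le> F T (t (Suc (Suc i)))" by force
      show "p' \<le> t (Suc 0) \<and> t (Suc (r - 1)) \<le> e \<and> F T p' + real d' / 4 \<le> F T (t (Suc 0)) \<and>
         (d' \<le> 2 \<and> (\<forall>i<r - 1. F T (t (Suc i)) + 1 \<le> F T (t (Suc (Suc i)))) \<or>
          d' = 3 \<and> (\<forall>i<r - 1. F T (t (Suc i)) + 3/4 \<le> F T (t (Suc (Suc i)))))"
        if "M T > 0"
      proof (intro conjI)
        show "d' \<le> 2 \<and> (\<forall>i<r - 1. F T (t (Suc i)) + 1 \<le> F T (t (Suc (Suc i)))) \<or>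
          d' = 3 \<and> (\<forall>i<r - 1. F T (t (Suc i)) + 3/4 \<le> F T (t (Suc (Suc i))))"
          using gap' gap'' p'(4) by (cases "d' = 3") auto
      qed (use that p' T num' in auto)
      show "(3 - k) * M T + k + 1 \<le> r + d'" by fact
      show "k = 0 \<or> k = 1 \<and> (0 < M S \<longrightarrow> (\<forall>i<r. F T (s (Suc i)) + 1/4 \<le> F T (t (Suc i)))) \<and>
        (M T < M S + d' \<or> (0 < M W \<longrightarrow> (\<forall>i<r. F T (w (Suc i)) + 1/4 \<le> F T (t (Suc i)))))"
        using inter M n'(2) by auto
    qed
    show ?thesis
    proof (cases "F T p + 3/4 \<le> F T L")
      case True
      obtain h where h: "p \<le> h" "h \<le> L" "F T p + 3/4 \<le> F T h"
        "\<And>x. p \<le> x \<Longrightarrow> x < h \<Longrightarrow> F T x < F T p + 3/4"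
        using first_hit[of p L "F T p + 3/4" "F T"] X(2) True by blast
      have ht: "h \<le> t 1"
      proof (rule ccontr)
        assume "\<not> h \<le> t 1"
        then have "F T (t 1) < F T p + 3/4" using h(4)[of "t 1"] t01 T by auto
        moreover have "F T p \<le> F T (t 0)" using T by (intro monoD[OF mono]) auto
        ultimately show False using t01 by simp
      qed
      \<comment> \<open>\<open>T\<close> takes the shortest piece worth 3/4. As
        \<open>h \<le> L\<close>, the piece ends before the next cuts of \<open>S\<close> and
        \<open>W\<close>; for \<open>k = 1\<close> the interleaving then leaves 1/4 before
        \<open>t 1\<close>.\<close>
      have "deals F e (N(T := N T - 1)) h"
      proof (rule next_state[where d' = k])
        show "F T h + real k / 4 \<le> F T (t 1)" if "(N(T := N T - 1)) T > 0"
        proof (cases "k = 0")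
          case True
          then show ?thesis using ht monoD[OF mono] by auto
        next
          case False
          then have k1: "k = 1" using k by simp
          show ?thesis
          proof (cases "N S > 0")
            case True
            then have "F T (s 1) + 1/4 \<le> F T (t 1)" using inter k1 num' by auto
            moreover have "F T h \<le> F T (s 1)" using L(1)[OF True] h(2) by (intro monoD[OF mono]) auto
            ultimately show ?thesis using k1 by simp
          next
            case nS: False
            \<comment> \<open>With \<open>N S = 0\<close>, \<open>d \<le> 2\<close> and at least two
              agents of type \<open>T\<close>, the inequality \<open>N T < N S + d\<close> fails. So
              the interleaving of \<open>w\<close> with \<open>t\<close> must be the alternative
              that holds.\<close>
            then have wt: "F T (w 1) + 1/4 \<le> F T (t 1)" and "N W > 0"
              using inter k1 num' that d2 NR by auto
            moreover have "F T h \<le> F T (w 1)" using L(2)[OF \<open>N W > 0\<close>] h(2) by (intro monoD[OF mono]) auto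
            ultimately show ?thesis using k1 by simp
          qed
        qed
        show "(3 - k) * (N(T := N T - 1)) T + k + 1 \<le> r + k"
          using k num d2 nT by auto
      qed (use NR types nT h ht k d2 in auto)
      then show ?thesis by (rule deals.serve[where F = F and N = N, OF nT h(1,3)])
    next
      case bad: False
      have "F T L < F T (t 1)"
      proof -
        have "F T p \<le> F T (t 0)" using T by (intro monoD[OF mono]) auto
        then show ?thesis using bad t01 by simp
      qed
      then have Lt: "L \<le> t 1" using mono_less_args[OF mono[of T]] by fastforce
      have "deals F e (N(X := N X - 1)) L"
      proof (rule next_state[where d' = "Suc d"])
        show "F T L + real (Suc d) / 4 \<le> F T (t 1)" using bad t01 T by (simp add: field_simps)
      qed (use NR types X d2 Lt num in \<open>auto simp: X_def split: if_splits\<close>)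
      then show ?thesis by (rule deals.serve[where F = F and N = N, OF X(1-3)])
    qed
  qed
qed

section \<open>Appending, reflecting and prescribing pieces\<close>

lemma deals_snoc:
  assumes "deals F e N p" and mono: "\<And>x. mono (F x)" and "e \<le> e'" "F t e + 3/4 \<le> F t e'"
  shows "deals F e' (N(t := Suc (N t))) p"
  using assms(1)
proof induction
  case (finish N p)
  have "F t p \<le> F t e" by (rule monoD[OF mono]) fact
  then have v: "F t p + 3/4 \<le> F t e'" using assms(4) by simp
  show ?case
  proof (rule deals.serve[where t = t and p' = e'])
    show "deals F e' ((N(t := Suc (N t)))(t := (N(t := Suc (N t))) t - 1)) e'"
      by (rule deals.finish) (use finish in auto)
  qed (use finish assms(3) v in auto)
next
  case (serve N s p p')
  show ?case
  proof (rule deals.serve[where t = s and p' = p'])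
    have "(N(t := Suc (N t)))(s := (N(t := Suc (N t))) s - 1)
        = (N(s := N s - 1))(t := Suc ((N(s := N s - 1)) t))"
      using serve(1) by (auto simp: fun_eq_iff)
    then show "deals F e' ((N(t := Suc (N t)))(s := (N(t := Suc (N t))) s - 1)) p'"
      using serve.IH by (simp only:)
  qed (use serve in auto)
qed

text \<open>Reflection turns the first piece into the last one. As \<open>deals\<close> is built
  from its leftmost piece, the induction appends at the right end through \<open>deals_snoc\<close>,
  which merges any stretch left over into the new piece.\<close>

lemma deals_mirror:
  assumes "deals F e N p" and mono: "\<And>x. mono (F x)"
  shows "deals (\<lambda>t x. - F t (- x)) (- p) N (- e)"
  using assms(1)
proof induction
  case (finish N p)
  then show ?case by (intro deals.finish) auto
next
  case (serve N t p p')
  have "mono (\<lambda>y. - F x (- y))" for x using mono[of x] unfolding mono_def by auto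
  moreover have "- p' \<le> - p" "- F t (- (- p')) + 3/4 \<le> - F t (- (- p))" using serve by auto
  ultimately have "deals (\<lambda>t x. - F t (- x)) (- p) ((N(t := N t - 1))(t := Suc ((N(t := N t - 1)) t))) (- e)"
    using deals_snoc[where F = "\<lambda>t x. - F t (- x)" and t = t, OF serve.IH] by blast
  moreover have "(N(t := N t - 1))(t := Suc ((N(t := N t - 1)) t)) = N"
    using serve(1) by (simp add: fun_eq_iff)
  ultimately show ?case by (simp only:)
qed

lemma deals_seq:
  assumes "\<And>i. i < r \<Longrightarrow> q i \<le> q (Suc i)"
    "\<And>i. i < r \<Longrightarrow> F (g i) (q i) + 3/4 \<le> F (g i) (q (Suc i))"
    "q r \<le> e" "\<And>t. N t = card {i. i < r \<and> g i = t}"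
  shows "deals F e N (q 0)"
  using assms
proof (induction r arbitrary: q g N)
  case 0
  then show ?case by (intro deals.finish) auto
next
  case (Suc r)
  have fin: "finite {i. i < k \<and> P i}" for k :: nat and P by simp
  have split: "{i. i < Suc r \<and> g i = t} = (if g 0 = t then insert 0 else id) (Suc ` {i. i < r \<and> g (Suc i) = t})" for t
    by (auto simp: image_iff less_Suc_eq_0_disj)
  have card: "N t = (if g 0 = t then 1 else 0) + card {i. i < r \<and> g (Suc i) = t}" for t
    unfolding Suc.prems(4) split by (auto simp: card_image card_insert_if)
  show ?case
  proof (rule deals.serve[where t = "g 0" and p' = "q 1"])
    show "deals F e (N(g 0 := N (g 0) - 1)) (q 1)"
    proof -
      have "(N(g 0 := N (g 0) - 1)) t = card {i. i < r \<and> g (Suc i) = t}" for t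
        using card[of t] by auto
      then have "deals F e (N(g 0 := N (g 0) - 1)) (q (Suc 0))"
        using Suc.prems(1-3) by (intro Suc.IH[of "\<lambda>i. q (Suc i)" "\<lambda>i. g (Suc i)"]) auto
      then show ?thesis by (simp only: One_nat_def)
    qed
  qed (use Suc.prems(1,2)[of 0] card[of "g 0"] in auto)
qed

section \<open>Position of points relative to the cuts of a type\<close>

definition mid :: "(int \<Rightarrow> real) \<Rightarrow> (int \<Rightarrow> int) \<Rightarrow> int \<Rightarrow> bool" where
  "mid f c x \<longleftrightarrow> (\<exists>k. f (c k) + 1/4 < f x \<and> f x + 1/4 < f (c (k + 1)))"

definition weave :: "(int \<Rightarrow> int) \<Rightarrow> (int \<Rightarrow> int) \<Rightarrow> bool" where
  "weave a b \<longleftrightarrow> (\<forall>k. a k < b k \<and> b k < a (k + 1))"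

lemma mid_shift: "mid f (\<lambda>k. c (k + g)) x \<longleftrightarrow> mid f c x"
proof -
  have "(\<exists>k. P k) \<longleftrightarrow> (\<exists>k. P (k + g))" for P :: "int \<Rightarrow> bool"
    by (metis diff_add_cancel)
  from this[of "\<lambda>k. f (c k) + 1/4 < f x \<and> f x + 1/4 < f (c (k + 1))"] show ?thesis
    unfolding mid_def by (simp add: algebra_simps)
qed

lemma mid_mirror: "mid (\<lambda>x. - f (- x)) (\<lambda>k. - c (- (k + g))) x \<longleftrightarrow> mid f c (- x)"
proof -
  have "(\<exists>k. P k) \<longleftrightarrow> (\<exists>k. P (- k - 1 - g))" for P :: "int \<Rightarrow> bool"
    by (metis add_diff_cancel minus_diff_eq)
  from this[of "\<lambda>k. f (c k) + 1/4 < f (- x) \<and> f (- x) + 1/4 < f (c (k + 1))"] show ?thesis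
    unfolding mid_def by (auto simp: algebra_simps)
qed

text \<open>The unrolled cycle with utilities scaled to maximin share 1: positions are integers,
  \<open>m\<close> is one turn, and each type has \<open>n\<close> cuts per turn. Differences of
  \<open>F t\<close> are values of stretches, hence \<open>F_period\<close> speaks of differences
  only.\<close>

locale cake =
  fixes F :: "'a::finite \<Rightarrow> int \<Rightarrow> real" and cut :: "'a \<Rightarrow> int \<Rightarrow> int"
    and m :: int and n :: nat and N :: "'a \<Rightarrow> nat"
  assumes mono: "mono (F t)"
    and gap: "F t (cut t k) + 1 \<le> F t (cut t (k + 1))"
    and period: "cut t (k + int n) = cut t k + m"
    and F_period: "F t (x + m) - F t x = F t (y + m) - F t y"
    and total: "sum N UNIV = n"
    and n_pos: "n > 0"
begin

lemma le_F: "x \<le> y \<Longrightarrow> F t x \<le> F t y"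
  by (rule monoD[OF mono])

lemma less_F: "F t x < F t y \<Longrightarrow> x < y"
  by (rule mono_less_args[OF mono])

lemma cut_step: "cut t k < cut t (k + 1)"
  using gap[of t k] by (intro less_F[of t]) simp

lemma cut_add: "cut t k + int i \<le> cut t (k + int i)"
proof (induction i)
  case (Suc i)
  then show ?case using cut_step[of t "k + int i"] by (simp add: algebra_simps)
qed simp

lemma cut_less: "i < j \<Longrightarrow> cut t i < cut t j"
  using cut_add[of t i "nat (j - i)"] by simp

lemma cut_le: "i \<le> j \<Longrightarrow> cut t i \<le> cut t j"
  using cut_less[of i j t] by (cases "i = j") auto

lemma cut_less_iff [simp]: "cut t i < cut t j \<longleftrightarrow> i < j"
  using cut_less cut_le by (metis not_le)

lemma cut_le_iff [simp]: "cut t i \<le> cut t j \<longleftrightarrow> i \<le> j"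
  using cut_less_iff by (metis not_le)

lemma between: obtains k where "cut t k \<le> x" "x < cut t (k + 1)"
proof -
  define M where "M = \<bar>x - cut t 0\<bar> + 1"
  have hi: "x < cut t M" using cut_add[of t 0 "nat M"] by (simp add: M_def)
  have lo: "cut t (- M) \<le> x" using cut_add[of t "- M" "nat M"] by (simp add: M_def)
  define K where "K = {- M..M} \<inter> {k. cut t k \<le> x}"
  have fin: "finite K" "- M \<in> K" using lo by (auto simp: K_def M_def)
  then have mem: "Max K \<in> K" by (intro Max_in) auto
  have "x < cut t (Max K + 1)"
  proof (rule ccontr)
    assume c: "\<not> x < cut t (Max K + 1)"
    then have "Max K + 1 < M" using hi by (meson cut_le_iff linorder_not_less order_less_le_trans)
    then have "Max K + 1 \<in> K" using mem c by (auto simp: K_def)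
    then show False using Max_ge[OF fin(1), of "Max K + 1"] by simp
  qed
  then show ?thesis using that mem by (auto simp: K_def)
qed

lemma mid_at:
  assumes "mid (F t) (cut t) x" "cut t k \<le> x" "x \<le> cut t (k + 1)"
  shows "F t (cut t k) + 1/4 < F t x" "F t x + 1/4 < F t (cut t (k + 1))"
proof -
  obtain j where j: "F t (cut t j) + 1/4 < F t x" "F t x + 1/4 < F t (cut t (j + 1))"
    using assms(1) unfolding mid_def by blast
  have "cut t j < x" "x < cut t (j + 1)" using j less_F[of t] by force+
  then have "cut t j < cut t (k + 1)" "cut t k < cut t (j + 1)" using assms(2,3) by linarith+
  then have "j = k" by simp
  then show "F t (cut t k) + 1/4 < F t x" "F t x + 1/4 < F t (cut t (k + 1))" using j by auto
qed

lemma not_mid_cut: "\<not> mid (F t) (cut t) (cut t k)"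
  using mid_at(1)[of t "cut t k" k] cut_step[of t k] by auto

lemma m_pos: "m > 0"
proof -
  have "cut undefined 0 < cut undefined (0 + int n)" using n_pos by simp
  then show ?thesis unfolding period by simp
qed

text \<open>An arc worth 1 can lose 1/4. If \<open>x\<close> is that close to the cut on its left,
  the first arc bears the loss; if it is close to the cut on its right, the part of the broken arc
  before \<open>x\<close> reappears at the end of the turn and serves as the last arc.\<close>

lemma free_cap:
  assumes "\<not> mid (F t) (cut t) x"
  shows "cap (F t) (x + m) n x"
proof -
  obtain k where k: "cut t k \<le> x" "x < cut t (k + 1)" using between .
  have "F t x \<le> F t (cut t k) + 1/4 \<or> F t (cut t (k + 1)) \<le> F t x + 1/4"
  proof (rule ccontr)
    assume "\<not> ?thesis"
    then have "mid (F t) (cut t) x" unfolding mid_def by (intro exI[of _ k]) auto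
    then show False using assms by simp
  qed
  then show ?thesis
  proof
    assume l: "F t x \<le> F t (cut t k) + 1/4"
    define q where "q i = (if i = 0 then x else cut t (k + int i))" for i :: nat
    have "F t (q i) + 3/4 \<le> F t (q (Suc i))" for i
      using l gap[of t k] gap[of t "k + int i"] by (auto simp: q_def algebra_simps)
    then show ?thesis unfolding cap_def using k n_pos period[of t k]
      by (intro exI[of _ q]) (auto simp: q_def)
  next
    assume r: "F t (cut t (k + 1)) \<le> F t x + 1/4"
    define q where "q i = (if i = n then x + m else cut t (k + 1 + int i))" for i :: nat
    have "F t (q i) + 3/4 \<le> F t (q (Suc i))" if "i < n" for i
    proof (cases "Suc i = n")
      case True
      then have "k + 1 + int i = k + int n" by simp
      then have "cut t (k + 1 + int i) = cut t k + m" using period[of t k] by (simp only:)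
      moreover have "F t (x + m) - F t (cut t k + m) = F t x - F t (cut t k)"
        using F_period[of t x "cut t k"] by simp
      ultimately show ?thesis using True that r gap[of t k] by (simp add: q_def)
    qed (use that gap[of t "k + 1 + int i"] in \<open>simp add: q_def algebra_simps\<close>)
    then show ?thesis unfolding cap_def using k n_pos
      by (intro exI[of _ q]) (auto simp: q_def)
  qed
qed

text \<open>A starting point inside an arc breaks it and leaves \<open>n - 1\<close> arcs with a
  leftover above 1/4, so \<open>d = 1\<close>. At any other point \<open>free_cap\<close> provides
  \<open>n\<close> arcs, the first of which plays the leftover with \<open>d = 3\<close>.\<close>

lemma tail:
  obtains s d where "x \<le> s 0" "s (n - 1) \<le> x + m" "F t x + real d / 4 \<le> F t (s 0)" "1 \<le> d"
    "d \<le> 2 \<and> (\<forall>i<n-1. F t (s i) + 1 \<le> F t (s (Suc i))) \<or>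
     d = 3 \<and> (\<forall>i<n-1. F t (s i) + 3/4 \<le> F t (s (Suc i)))"
proof (cases "mid (F t) (cut t) x")
  case True
  obtain k where k: "cut t k \<le> x" "x < cut t (k + 1)" using between .
  have "cut t (k + 1 + int (n - 1)) = cut t k + m"
    using period[of t k] n_pos by (simp add: algebra_simps of_nat_diff)
  then have "cut t (k + 1 + int (n - 1)) \<le> x + m" using k by simp
  moreover have "F t (cut t (k + 1 + int i)) + 1 \<le> F t (cut t (k + 1 + int (Suc i)))" for i
    using gap[of t "k + 1 + int i"] by (simp add: algebra_simps)
  ultimately show ?thesis
    using that[of "\<lambda>i. cut t (k + 1 + int i)" 1] k mid_at[OF True, of k] by simp
next
  case False
  from free_cap[OF this] obtain q where q: "x \<le> q 0" "q n \<le> x + m"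
    "\<And>i. i < n \<Longrightarrow> F t (q i) + 3/4 \<le> F t (q (Suc i))"
    unfolding cap_def by blast
  have "F t x + 3/4 \<le> F t (q 1)" using q(3)[of 0] le_F[OF q(1), of t] n_pos by simp
  then have "x \<le> q 1" using less_F[of t x "q 1"] by simp
  then show ?thesis
    using that[of "\<lambda>i. q (Suc i)" 3] \<open>F t x + 3/4 \<le> F t (q 1)\<close> q n_pos by auto
qed

end

text \<open>The assumption to be refuted: no starting point allows all agents to be served within
  one turn.\<close>

locale stuck = cake +
  assumes stuck: "\<not> deals F (p + m) N p"
begin

lemma stuck_shift: "stuck F (\<lambda>t k. cut t (k + g t)) m n N"
proof unfold_locales
  show "F t (cut t (k + g t)) + 1 \<le> F t (cut t (k + 1 + g t))" for t k
    using gap[of t "k + g t"] by (simp add: algebra_simps)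
  show "cut t (k + int n + g t) = cut t (k + g t) + m" for t k
    using period[of t "k + g t"] by (simp add: algebra_simps)
qed (use mono F_period total n_pos stuck in auto)

text \<open>Reversing the cycle swaps the order of alternating cuts; the shifts \<open>g\<close> restore it.\<close>
lemma stuck_mirror: "stuck (\<lambda>t x. - F t (- x)) (\<lambda>t k. - cut t (- (k + g t))) m n N"
proof unfold_locales
  have mono': "mono (\<lambda>x. - F t (- x))" for t using mono[of t] unfolding mono_def by auto
  show "mono (\<lambda>x. - F t (- x))" for t by fact
  show "- F t (- (- cut t (- (k + g t)))) + 1 \<le> - F t (- (- cut t (- (k + 1 + g t))))" for t k
    using gap[of t "- (k + 1 + g t)"] by (simp add: algebra_simps)
  show "- cut t (- (k + int n + g t)) = - cut t (- (k + g t)) + m" for t k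
    using period[of t "- (k + int n + g t)"] by (simp add: algebra_simps)
  show "- F t (- (x + m)) - - F t (- x) = - F t (- (y + m)) - - F t (- y)" for t x y
    using F_period[of t "- x - m" "- y - m"] by simp
  show "\<not> deals (\<lambda>t x. - F t (- x)) (p + m) N p" for p
  proof
    assume "deals (\<lambda>t x. - F t (- x)) (p + m) N p"
    from deals_mirror[OF this mono'] show False using stuck[of "- p - m"] by simp
  qed
qed (use total n_pos in auto)

lemma path_stuck:
  assumes "\<And>t. N t > 0 \<Longrightarrow> \<not> mid (F t) (cut t) x"
  shows False
  using deals_path[where F = F and p = x and e = "x + m", OF mono total] free_cap assms stuck m_pos by auto

text \<open>This is \<open>knife\<close> over a full turn, with \<open>R = n\<close>. For
  \<open>d = 1\<close> the count reads \<open>3 * N T \<le> n\<close> if \<open>k = 0\<close> and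
  \<open>2 * N T < n\<close> if \<open>k = 1\<close>; the weaker bound is paid for by interleaved
  cuts.\<close>

lemma knife_stuck:
  assumes "UNIV = {S, W, T}" "S \<noteq> W" "S \<noteq> T" "W \<noteq> T"
    and "N S > 0 \<Longrightarrow> p \<le> s 0" "N S > 0 \<Longrightarrow> s n \<le> p + m"
      "\<And>i. N S > 0 \<Longrightarrow> i < n \<Longrightarrow> F S (s i) + 3/4 \<le> F S (s (Suc i))"
    and "N W > 0 \<Longrightarrow> w n \<le> p + m"
      "\<And>i. N W > 0 \<Longrightarrow> i < n \<Longrightarrow> 0 < i \<Longrightarrow> F W (w i) + 3/4 \<le> F W (w (Suc i))"
      "N W > 0 \<Longrightarrow> p \<le> w 0 \<and> F W (w 0) + 3/4 \<le> F W (w 1) \<or> N S > 0 \<and> s 1 \<le> w 1"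
    and "p \<le> t 0" "t (n - 1) \<le> p + m" "F T p + real d / 4 \<le> F T (t 0)"
      "d \<le> 2 \<and> (\<forall>i<n-1. F T (t i) + 1 \<le> F T (t (Suc i))) \<or>
       d = 3 \<and> (\<forall>i<n-1. F T (t i) + 3/4 \<le> F T (t (Suc i)))"
    and "(3 - k) * N T + k + 1 \<le> n + d"
    and "k = 0 \<or> k = 1 \<and> (\<forall>i<n. F T (s i) + 1/4 \<le> F T (t i)) \<and>
       (N T < N S + d \<or> (\<forall>i<n. F T (w i) + 1/4 \<le> F T (t i)))"
  shows False
proof -
  have "sum N UNIV = N S + N W + N T"
    unfolding assms(1) using assms(2-4) by simp
  then have "N S + N W + N T = n" using total by simp
  from knife[OF mono assms(1-4) this, where p = p and e = "p + m" and s = s and w = w and t = t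
      and d = d and k = k] show False
    using assms(5-) m_pos stuck[of p] by auto
qed

end

section \<open>Forced alternation of the cuts\<close>

definition trio :: "'a \<Rightarrow> 'a \<Rightarrow> 'a \<Rightarrow> bool" where
  "trio A B C \<longleftrightarrow> UNIV = {A, B, C} \<and> A \<noteq> B \<and> A \<noteq> C \<and> B \<noteq> C"

lemma trio_perm: "trio A B C \<Longrightarrow> trio B A C" "trio A B C \<Longrightarrow> trio A C B"
  unfolding trio_def by auto

lemma trioD: "trio A B C \<Longrightarrow> UNIV = {A, B, C}" "trio A B C \<Longrightarrow> A \<noteq> B" "trio A B C \<Longrightarrow> A \<noteq> C" "trio A B C \<Longrightarrow> B \<noteq> C"
  unfolding trio_def by auto

lemma trio_cases: "trio A B C \<Longrightarrow> x = A \<or> x = B \<or> x = C"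
  unfolding trio_def by (metis UNIV_I empty_iff insert_iff)

lemma weaveD: "weave a b \<Longrightarrow> a k < b k" "weave a b \<Longrightarrow> b k < a (k + 1)"
  unfolding weave_def by auto

text \<open>In the reflected order the cut that follows \<open>- a (- k)\<close> is
  \<open>- b (- (k + 1))\<close>, hence the shift of \<open>b\<close> by one.\<close>

lemma weave_mirror:
  assumes "weave a b" "g = 0" "h = 1"
  shows "weave (\<lambda>k. - a (- (k + g))) (\<lambda>k. - b (- (k + h)))"
  unfolding weave_def
proof (intro allI conjI)
  fix k :: int
  have e: "- (k + 1) + 1 = - (k + 0)" by simp
  show "- a (- (k + g)) < - b (- (k + h))"
    using weaveD(2)[OF assms(1), of "- (k + 1)"] unfolding assms(2,3) e by (simp only: neg_less_iff_less)
  show "- b (- (k + h)) < - a (- (k + 1 + g))"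
    using weaveD(1)[OF assms(1), of "- (k + 1)"] unfolding assms(2,3) by simp
qed

section \<open>Indexing of alternating cuts\<close>

context cake
begin

abbreviation inside :: "'a \<Rightarrow> int \<Rightarrow> bool" where
  "inside t x \<equiv> mid (F t) (cut t) x"

lemma gap_nat: "F t (cut t (k + int i)) + 1 \<le> F t (cut t (k + int (Suc i)))"
  using gap[of t "k + int i"] by (simp add: algebra_simps)

lemma gap_nat': "F t (cut t (k + int i)) + 3/4 \<le> F t (cut t (k + int (Suc i)))"
  using gap_nat[of t k i] by linarith

lemma period_pred: "cut t (k + int (n - 1)) = cut t (k - 1) + m"
proof -
  have "k + int (n - 1) = k - 1 + int n" using n_pos by auto
  then show ?thesis using period[of t "k - 1"] by (simp only:)
qed

lemma weave_left:
  assumes "weave (cut X) (cut Y)" "inside Y (cut X k)"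
  shows "F Y (cut Y (k - 1)) + 1/4 < F Y (cut X k)" "F Y (cut X k) + 1/4 < F Y (cut Y k)"
  using mid_at[OF assms(2), of "k - 1"] weaveD[OF assms(1), of k] weaveD[OF assms(1), of "k - 1"]
  by auto

lemma weave_right:
  assumes "weave (cut X) (cut Y)" "inside X (cut Y k)"
  shows "F X (cut X k) + 1/4 < F X (cut Y k)" "F X (cut Y k) + 1/4 < F X (cut X (k + 1))"
  using mid_at[OF assms(2), of k] weaveD[OF assms(1), of k] by auto

text \<open>Let \<open>G k\<close> be the index of the arc of \<open>B\<close> that contains
  \<open>cut A k\<close>. No arc of \<open>B\<close> contains a whole arc of \<open>A\<close>, so
  \<open>G\<close> grows by at least 1 per step; over one turn of \<open>n\<close> steps it can gain
  only \<open>n\<close>, so every step is exactly 1 and \<open>G\<close> is a translation.\<close>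

lemma alternate:
  assumes ins: "\<And>k. inside B (cut A k)"
    and no: "\<And>k j. cut B j \<le> cut A k \<Longrightarrow> cut A (k + 1) \<le> cut B (j + 1) \<Longrightarrow> False"
  shows "\<exists>g. weave (cut A) (\<lambda>k. cut B (k + g))"
proof -
  have "\<exists>j. cut B j < cut A k \<and> cut A k < cut B (j + 1)" for k
  proof -
    obtain j where "F B (cut B j) + 1/4 < F B (cut A k)" "F B (cut A k) + 1/4 < F B (cut B (j + 1))"
      using ins[of k] unfolding mid_def by blast
    then show ?thesis using less_F[of B "cut B j" "cut A k"] less_F[of B "cut A k" "cut B (j + 1)"]
      by (intro exI[of _ j]) simp
  qed
  then obtain G where G: "\<And>k. cut B (G k) < cut A k" "\<And>k. cut A k < cut B (G k + 1)" by metis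
  have step: "G k + 1 \<le> G (k + 1)" for k
  proof -
    have "cut B (G k) < cut B (G (k + 1) + 1)"
      using G(1)[of k] G(2)[of "k + 1"] cut_step[of A k] by linarith
    then have "G k \<le> G (k + 1)" by simp
    moreover have "G k \<noteq> G (k + 1)"
      using no[of "G k" k] G(1)[of k] G(2)[of "k + 1"] by (metis less_imp_le)
    ultimately show ?thesis by linarith
  qed
  have steps: "G k + int i \<le> G (k + int i)" for k i
  proof (induction i)
    case (Suc i)
    then show ?case using step[of "k + int i"] by (simp add: algebra_simps)
  qed simp
  have "G (k + int n) \<le> G k + int n" for k
  proof -
    have "cut B (G (k + int n)) < cut B (G k + 1) + m"
      using G(1)[of "k + int n"] G(2)[of k] period[of A k] by linarith
    then have "cut B (G (k + int n)) < cut B (G k + 1 + int n)" by (simp only: period)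
    then show ?thesis by simp
  qed
  moreover have "G (k + 1) + int (n - 1) \<le> G (k + int n)" for k
    using steps[of "k + 1" "n - 1"] n_pos by (simp add: algebra_simps of_nat_diff)
  moreover have "int (n - 1) = int n - 1" using n_pos by simp
  ultimately have eq: "G (k + 1) = G k + 1" for k using step[of k] by (smt (verit))
  have lin: "G k = k + G 0" for k
  proof (induction k rule: int_induct[where k = 0])
    case (step2 i)
    then show ?case using eq[of "i - 1"] by simp
  qed (use eq in auto)
  have "weave (cut A) (\<lambda>k. cut B (k + (G 0 + 1)))"
    unfolding weave_def
  proof (intro allI conjI)
    fix k
    show "cut A k < cut B (k + (G 0 + 1))" using G(2)[of k] lin[of k] by (simp add: algebra_simps)
    show "cut B (k + (G 0 + 1)) < cut A (k + 1)"
      using G(1)[of "k + 1"] lin[of "k + 1"] by (simp add: algebra_simps)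
  qed
  then show ?thesis by blast
qed

end

section \<open>Starting points that would yield an allocation\<close>

context stuck
begin

text \<open>If \<open>x\<close> were inside for neither type, \<open>A\<close> and \<open>B\<close>
  would keep \<open>n\<close> arcs from \<open>x\<close> on. Only \<open>C\<close> could lack one,
  and it is small enough for \<open>k = 0\<close>.\<close>

lemma inside_either:
  assumes t: "trio A B C" and "3 * N C \<le> n"
  shows "inside A x \<or> inside B x"
proof (rule ccontr)
  assume "\<not> ?thesis"
  then have "cap (F A) (x + m) n x" "cap (F B) (x + m) n x" using free_cap by auto
  then obtain s w where s: "x \<le> s 0" "s n \<le> x + m" "\<And>i. i < n \<Longrightarrow> F A (s i) + 3/4 \<le> F A (s (Suc i))"
    and w: "x \<le> w 0" "w n \<le> x + m" "\<And>i. i < n \<Longrightarrow> F B (w i) + 3/4 \<le> F B (w (Suc i))"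
    unfolding cap_def by (elim exE conjE) auto
  obtain r d where "x \<le> r 0" "r (n - 1) \<le> x + m" "F C x + real d / 4 \<le> F C (r 0)" "1 \<le> d"
    "d \<le> 2 \<and> (\<forall>i<n-1. F C (r i) + 1 \<le> F C (r (Suc i))) \<or>
     d = 3 \<and> (\<forall>i<n-1. F C (r i) + 3/4 \<le> F C (r (Suc i)))" by (rule tail[of x C])
  then show False
    by (intro knife_stuck[of A B C x s w r d 0]) (use trioD[OF t] s w w(3)[of 0] assms(2) n_pos in auto)
qed

text \<open>Start at \<open>cut A k\<close>. \<open>A\<close> keeps all arcs, and \<open>B\<close>
  lacks its first arc, but its next cut comes after that of \<open>A\<close>; this is the deficit
  that \<open>knife\<close> allows for \<open>W\<close>. \<open>C\<close> is handled with
  \<open>k = 0\<close>.\<close>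

lemma no_nesting:
  assumes t: "trio A B C" and "3 * N C \<le> n" "N A > 0"
    and nest: "cut B j \<le> cut A k" "cut A (k + 1) \<le> cut B (j + 1)"
  shows False
proof -
  let ?x = "cut A k"
  obtain r d where "?x \<le> r 0" "r (n - 1) \<le> ?x + m" "F C ?x + real d / 4 \<le> F C (r 0)" "1 \<le> d"
    "d \<le> 2 \<and> (\<forall>i<n-1. F C (r i) + 1 \<le> F C (r (Suc i))) \<or>
     d = 3 \<and> (\<forall>i<n-1. F C (r i) + 3/4 \<le> F C (r (Suc i)))" by (rule tail[of ?x C])
  then show False
    by (intro knife_stuck[of A B C ?x "\<lambda>i. cut A (k + int i)" "\<lambda>i. cut B (j + int i)" r d 0])
       (use trioD[OF t] gap_nat' nest assms(2,3) period in auto)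
qed

text \<open>Otherwise a start at \<open>cut A k\<close> leaves all arcs to both \<open>A\<close> and
  \<open>C\<close>. Only \<open>B\<close> lacks one, and each of its cuts follows the matching cut
  of \<open>A\<close> by more than 1/4 in its own value, so \<open>k = 1\<close> applies;
  \<open>N B \<le> N A\<close> is the condition \<open>N T < N S + d\<close> for
  \<open>d = 1\<close>.\<close>

lemma third_inside:
  assumes t: "trio A B C" and wv: "weave (cut A) (cut B)" and ins: "\<And>k. inside B (cut A k)"
    and NB: "N B \<le> N A" "2 * N B < n"
  shows "inside C (cut A k)"
proof (rule ccontr)
  let ?x = "cut A k"
  assume "\<not> ?thesis"
  then have "cap (F C) (?x + m) n ?x" using free_cap by auto
  then obtain w where w: "?x \<le> w 0" "w n \<le> ?x + m" "\<And>i. i < n \<Longrightarrow> F C (w i) + 3/4 \<le> F C (w (Suc i))"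
    unfolding cap_def by (elim exE conjE) auto
  show False
  proof (rule knife_stuck[of A C B ?x "\<lambda>i. cut A (k + int i)" w "\<lambda>i. cut B (k + int i)" 1 1])
    show "cut B (k + int (n - 1)) \<le> cut A k + m"
      unfolding period_pred using weaveD(2)[OF wv, of "k - 1"] by simp
    show "F B (cut A k) + real 1 / 4 \<le> F B (cut B (k + int 0))"
      using weave_left(2)[OF wv ins, of k] by simp
    show "1 = (0::nat) \<or> 1 = (1::nat) \<and> (\<forall>i<n. F B (cut A (k + int i)) + 1/4 \<le> F B (cut B (k + int i))) \<and>
       (N B < N A + 1 \<or> (\<forall>i<n. F B (w i) + 1/4 \<le> F B (cut B (k + int i))))"
      using weave_left(2)[OF wv ins] NB less_imp_le by auto
  qed (use trioD[OF t] gap_nat gap_nat' NB period w w(3)[of 0] n_pos weaveD(1)[OF wv, of k] in auto)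
qed

text \<open>The start and the role of \<open>B\<close> are those of \<open>third_inside\<close>;
  \<open>C\<close> lacks its first arc in the way permitted for \<open>W\<close>, because the next
  cut of \<open>A\<close> precedes that of \<open>C\<close>.\<close>

lemma third_no_nesting:
  assumes t: "trio A B C" and wv: "weave (cut A) (cut B)" and ins: "\<And>k. inside B (cut A k)"
    and NB: "N B \<le> N A" "2 * N B < n" "N A > 0"
    and nest: "cut C j \<le> cut A k" "cut A (k + 1) \<le> cut C (j + 1)"
  shows False
proof (rule knife_stuck[of A C B "cut A k" "\<lambda>i. cut A (k + int i)" "\<lambda>i. cut C (j + int i)"
      "\<lambda>i. cut B (k + int i)" 1 1])
  show "cut B (k + int (n - 1)) \<le> cut A k + m"
    unfolding period_pred using weaveD(2)[OF wv, of "k - 1"] by simp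
  show "F B (cut A k) + real 1 / 4 \<le> F B (cut B (k + int 0))"
    using weave_left(2)[OF wv ins, of k] by simp
  show "1 = (0::nat) \<or> 1 = (1::nat) \<and> (\<forall>i<n. F B (cut A (k + int i)) + 1/4 \<le> F B (cut B (k + int i))) \<and>
     (N B < N A + 1 \<or> (\<forall>i<n. F B (cut C (j + int i)) + 1/4 \<le> F B (cut B (k + int i))))"
    using weave_left(2)[OF wv ins] NB less_imp_le by auto
qed (use trioD[OF t] gap_nat gap_nat' NB period nest weaveD(1)[OF wv, of k] in auto)

text \<open>Start at \<open>cut C k\<close>: the shortened first arc of \<open>A\<close> is still
  worth 3/4, and \<open>C\<close> stands on its own cut. Only \<open>B\<close> lacks an arc, and its
  cuts stay more than 1/4 behind the points used for \<open>A\<close>, so \<open>k = 1\<close>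
  applies.\<close>

lemma inside_back_half:
  assumes t: "trio A B C" and wB: "weave (cut A) (cut B)" and wC: "weave (cut A) (cut C)"
    and ins: "\<And>k. inside B (cut A k)" "inside B (cut C k)"
    and NB: "N B \<le> N A" "2 * N B < n"
    and half: "F A (cut C k) \<le> F A (cut A k) + 1/4"
  shows False
proof -
  let ?p = "cut C k"
  \<comment> \<open>The cut of \<open>B\<close> in this arc of \<open>A\<close> may lie on either
    side of \<open>cut C k\<close>; \<open>j\<close> is the index of the first cut of
    \<open>B\<close> that is not before the start.\<close>
  define j where "j = (if ?p \<le> cut B k then k else k + 1)"
  have j: "k \<le> j" "?p \<le> cut B j" "cut B (j - 1) \<le> ?p"
    using weaveD[OF wB, of "k - 1"] weaveD[OF wB, of "k + 1"] weaveD[OF wC, of k] by (auto simp: j_def)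
  have "F B ?p + 1/4 < F B (cut B j)" using mid_at(2)[OF ins(2), of "j - 1"] j by simp
  have inter: "F B (if i = 0 then ?p else cut A (k + int i)) + 1/4 \<le> F B (cut B (j + int i))" for i :: nat
  proof (cases "i = 0")
    case False
    have "F B (cut B (k + int i)) \<le> F B (cut B (j + int i))" using j by (intro le_F) simp
    then show ?thesis using weave_left(2)[OF wB ins(1), of "k + int i"] False by simp
  qed (use \<open>F B ?p + 1/4 < F B (cut B j)\<close> in simp)
  have chain: "F A (if i = 0 then ?p else cut A (k + int i)) + 3/4 \<le> F A (cut A (k + 1 + int i))" for i :: nat
    using gap_nat'[of A k i] gap_nat[of A k i] half by (auto simp: algebra_simps)
  show False
  proof (rule knife_stuck[of A C B ?p "\<lambda>i. if i = 0 then ?p else cut A (k + int i)" "\<lambda>i. cut C (k + int i)"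
      "\<lambda>i. cut B (j + int i)" 1 1])
    show "cut B (j + int (n - 1)) \<le> ?p + m" unfolding period_pred using j by simp
    show "F A (if i = 0 then ?p else cut A (k + int i)) + 3/4 \<le> F A (if Suc i = 0 then ?p else cut A (k + int (Suc i)))" for i :: nat
      using chain[of i] by (simp add: algebra_simps)
    show "1 = (0::nat) \<or> 1 = (1::nat) \<and> (\<forall>i<n. F B (if i = 0 then ?p else cut A (k + int i)) + 1/4 \<le> F B (cut B (j + int i))) \<and>
       (N B < N A + 1 \<or> (\<forall>i<n. F B (cut C (k + int i)) + 1/4 \<le> F B (cut B (j + int i))))"
      using inter NB by auto
    show "F B ?p + real 1 / 4 \<le> F B (cut B (j + int 0))" using inter[of 0] by simp
    show "(if n = 0 then ?p else cut A (k + int n)) \<le> ?p + m"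
      using weaveD(1)[OF wC, of k] n_pos period[of A k] by simp
    show "F C (cut C (k + int i)) + 3/4 \<le> F C (cut C (k + int (Suc i)))" for i by (rule gap_nat')
    show "?p \<le> cut C (k + int 0) \<and> F C (cut C (k + int 0)) + 3/4 \<le> F C (cut C (k + int 1)) \<or>
      0 < N A \<and> (if 1 = (0::nat) then ?p else cut A (k + int 1)) \<le> cut C (k + int 1)"
      using gap_nat'[of C k 0] by simp
    show "(1::nat) \<le> 2 \<and> (\<forall>i<n - 1. F B (cut B (j + int i)) + 1 \<le> F B (cut B (j + int (Suc i)))) \<or>
      1 = (3::nat) \<and> (\<forall>i<n - 1. F B (cut B (j + int i)) + 3/4 \<le> F B (cut B (j + int (Suc i))))"
      by (intro disjI1 conjI allI impI gap_nat) simp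
  qed (use trioD[OF t] NB period j in auto)
qed

text \<open>A cut of \<open>C\<close> that is not inside for \<open>A\<close> is close to the left
  or to the right end of its arc of \<open>A\<close>. The left end is
  \<open>inside_back_half\<close>, and reflection exchanges the two.\<close>

lemma inside_back:
  assumes t: "trio A B C" and wB: "weave (cut A) (cut B)" and wC: "weave (cut A) (cut C)"
    and ins: "\<And>k. inside B (cut A k)" and NB: "N B \<le> N A" "2 * N B < n"
  shows "inside A (cut C k)"
proof (rule ccontr)
  assume out: "\<not> ?thesis"
  have insB: "inside B (cut C k)"
  proof (rule ccontr)
    \<comment> \<open>A point that is inside for no type breaks no arc in a harmful way.\<close>
    assume "\<not> inside B (cut C k)"
    then show False using path_stuck[of "cut C k"] out not_mid_cut trio_cases[OF t] by metis
  qed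
  have "F A (cut C k) \<le> F A (cut A k) + 1/4 \<or> F A (cut A (k + 1)) \<le> F A (cut C k) + 1/4"
  proof (rule ccontr)
    assume "\<not> ?thesis"
    then have "inside A (cut C k)" unfolding mid_def by (intro exI[of _ k]) auto
    then show False using out by simp
  qed
  then show False
  proof
    assume "F A (cut C k) \<le> F A (cut A k) + 1/4"
    then show False by (rule inside_back_half[OF t wB wC ins insB NB])
  next
    assume half: "F A (cut A (k + 1)) \<le> F A (cut C k) + 1/4"
    \<comment> \<open>Reflection turns the arc of \<open>A\<close> with index \<open>k\<close> into
      the one with index \<open>- k - 1\<close>; the shift by one moves \<open>B\<close> and
      \<open>C\<close> along, so that they again follow \<open>A\<close>.\<close>
    define g where "g t = (if t = A then 0 else 1 :: int)" for t
    have g: "g A = 0" "g B = 1" "g C = 1" using trioD[OF t] by (auto simp: g_def)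
    interpret M: stuck "\<lambda>t x. - F t (- x)" "\<lambda>t k. - cut t (- (k + g t))" m n N by (rule stuck_mirror)
    note wv = weave_mirror[where g = "g A", OF _ g(1)]
    show False
    proof (rule M.inside_back_half[OF t wv[OF wB g(2)] wv[OF wC g(3)] _ _ NB, of "- k - 1"])
      show "mid (\<lambda>x. - F B (- x)) (\<lambda>k. - cut B (- (k + g B))) (- cut A (- (j + g A)))" for j
        unfolding mid_mirror using ins by simp
      show "mid (\<lambda>x. - F B (- x)) (\<lambda>k. - cut B (- (k + g B))) (- cut C (- (- k - 1 + g C)))"
        unfolding mid_mirror using insB g by simp
      show "- F A (- (- cut C (- (- k - 1 + g C)))) \<le> - F A (- (- cut A (- (- k - 1 + g A)))) + 1/4"
        using half g by (simp add: algebra_simps)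
    qed
  qed
qed

text \<open>Start at \<open>cut Y k\<close>: \<open>Y\<close> keeps all arcs and the first arc of
  \<open>Z\<close> loses at most 1/4. \<open>X\<close> lacks an arc, and the cuts of both
  \<open>Y\<close> and \<open>Z\<close> precede its next cut by more than 1/4, which is the second
  alternative for \<open>k = 1\<close>.\<close>

lemma inside_other_half:
  assumes t: "trio X Y Z" and wY: "weave (cut X) (cut Y)" and wZ: "weave (cut X) (cut Z)"
    and ins: "\<And>k. inside X (cut Y k)" "\<And>k. inside X (cut Z k)"
    and NX: "2 * N X < n"
    and half: "cut Z k \<le> cut Y k" "F Z (cut Y k) \<le> F Z (cut Z k) + 1/4"
  shows False
proof -
  let ?p = "cut Y k"
  have x: "F X (cut Y j) + 1/4 < F X (cut X (j + 1))" "F X (cut Z j) + 1/4 < F X (cut X (j + 1))" for j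
    using weave_right(2)[OF wY ins(1)] weave_right(2)[OF wZ ins(2)] by auto
  have chain: "F Z (if i = 0 then ?p else cut Z (k + int i)) + 3/4 \<le> F Z (cut Z (k + 1 + int i))" for i :: nat
    using gap_nat'[of Z k i] gap_nat[of Z k i] half by (auto simp: algebra_simps)
  show False
  proof (rule knife_stuck[of Y Z X ?p "\<lambda>i. cut Y (k + int i)" "\<lambda>i. if i = 0 then ?p else cut Z (k + int i)"
      "\<lambda>i. cut X (k + 1 + int i)" 1 1])
    show "cut X (k + 1 + int (n - 1)) \<le> ?p + m"
      unfolding period_pred using weaveD(1)[OF wY, of k] by simp
    show "F Z (if i = 0 then ?p else cut Z (k + int i)) + 3/4 \<le> F Z (if Suc i = 0 then ?p else cut Z (k + int (Suc i)))" for i :: nat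
      using chain[of i] by (simp add: algebra_simps)
    show "F X ?p + real 1 / 4 \<le> F X (cut X (k + 1 + int 0))" using x(1)[of k] by simp
    show "1 = (0::nat) \<or> 1 = (1::nat) \<and> (\<forall>i<n. F X (cut Y (k + int i)) + 1/4 \<le> F X (cut X (k + 1 + int i))) \<and>
       (N X < N Y + 1 \<or> (\<forall>i<n. F X (if i = 0 then ?p else cut Z (k + int i)) + 1/4 \<le> F X (cut X (k + 1 + int i))))"
    proof (intro disjI2 conjI allI impI)
      fix i
      show "F X (cut Y (k + int i)) + 1/4 \<le> F X (cut X (k + 1 + int i))"
        using x(1)[of "k + int i"] by (simp add: algebra_simps)
      show "F X (if i = 0 then ?p else cut Z (k + int i)) + 1/4 \<le> F X (cut X (k + 1 + int i))"
        using x(1)[of "k + int i"] x(2)[of "k + int i"] by (cases "i = 0") (simp_all add: algebra_simps)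
    qed simp
    show "F Y (cut Y (k + int i)) + 3/4 \<le> F Y (cut Y (k + int (Suc i)))" for i by (rule gap_nat')
    show "(if n = 0 then ?p else cut Z (k + int n)) \<le> ?p + m" using half n_pos period[of Z k] by simp
    show "?p \<le> (if (0::nat) = 0 then ?p else cut Z (k + int 0)) \<and>
      F Z (if (0::nat) = 0 then ?p else cut Z (k + int 0)) + 3/4 \<le> F Z (if (1::nat) = 0 then ?p else cut Z (k + int 1)) \<or>
      0 < N Y \<and> cut Y (k + int 1) \<le> (if (1::nat) = 0 then ?p else cut Z (k + int 1))"
      using chain[of 0] by simp
    show "(1::nat) \<le> 2 \<and> (\<forall>i<n - 1. F X (cut X (k + 1 + int i)) + 1 \<le> F X (cut X (k + 1 + int (Suc i)))) \<or>
      1 = (3::nat) \<and> (\<forall>i<n - 1. F X (cut X (k + 1 + int i)) + 3/4 \<le> F X (cut X (k + 1 + int (Suc i))))"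
      by (intro disjI1 conjI allI impI gap_nat) simp
    show "?p \<le> cut X (k + 1 + int 0)" using weaveD(2)[OF wY, of k] by simp
  qed (use trioD[OF t] NX period in auto)
qed

text \<open>The cuts of \<open>X\<close> around \<open>cut Y k\<close> are inside for
  \<open>Z\<close>, which keeps \<open>cut Y k\<close> away from all cuts of \<open>Z\<close> except
  \<open>cut Z k\<close>. The two possible orders of \<open>cut Y k\<close> and
  \<open>cut Z k\<close> are exchanged by reflection.\<close>

lemma inside_other:
  assumes t: "trio X Y Z" and wY: "weave (cut X) (cut Y)" and wZ: "weave (cut X) (cut Z)"
    and ins: "\<And>k. inside X (cut Y k)" "\<And>k. inside X (cut Z k)" "\<And>k. inside Z (cut X k)"
    and NX: "2 * N X < n"
  shows "inside Z (cut Y k)"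
proof (rule ccontr)
  assume out: "\<not> ?thesis"
  have xz: "F Z (cut Z (k - 1)) + 1/4 < F Z (cut X k)" "F Z (cut X (k + 1)) + 1/4 < F Z (cut Z (k + 1))"
    using weave_left[OF wZ ins(3), of k] weave_left[OF wZ ins(3), of "k + 1"] by simp_all
  show False
  proof (cases "cut Z k \<le> cut Y k")
    case True
    have "F Z (cut Y k) \<le> F Z (cut X (k + 1))" using weaveD[OF wY, of k] by (intro le_F) simp
    then have "F Z (cut Y k) + 1/4 < F Z (cut Z (k + 1))" using xz by simp
    moreover have "\<not> (F Z (cut Z k) + 1/4 < F Z (cut Y k) \<and> F Z (cut Y k) + 1/4 < F Z (cut Z (k + 1)))"
      using out unfolding mid_def by blast
    ultimately have "F Z (cut Y k) \<le> F Z (cut Z k) + 1/4" by linarith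
    then show False by (rule inside_other_half[OF t wY wZ ins(1,2) NX True])
  next
    case False
    have "F Z (cut X k) \<le> F Z (cut Y k)" using weaveD[OF wY, of k] by (intro le_F) simp
    then have "F Z (cut Z (k - 1)) + 1/4 < F Z (cut Y k)" using xz by simp
    moreover have "\<not> (F Z (cut Z (k - 1)) + 1/4 < F Z (cut Y k) \<and> F Z (cut Y k) + 1/4 < F Z (cut Z (k - 1 + 1)))"
      using out unfolding mid_def by blast
    ultimately have half: "F Z (cut Z k) \<le> F Z (cut Y k) + 1/4" by simp
    define g where "g t = (if t = X then 0 else 1 :: int)" for t
    have g: "g X = 0" "g Y = 1" "g Z = 1" using trioD[OF t] by (auto simp: g_def)
    interpret M: stuck "\<lambda>t x. - F t (- x)" "\<lambda>t k. - cut t (- (k + g t))" m n N by (rule stuck_mirror)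
    note wv = weave_mirror[where g = "g X", OF _ g(1)]
    show False
    proof (rule M.inside_other_half[OF t wv[OF wY g(2)] wv[OF wZ g(3)] _ _ NX, of "- k - 1"])
      show "mid (\<lambda>x. - F X (- x)) (\<lambda>k. - cut X (- (k + g X))) (- cut Y (- (j + g Y)))" for j
        unfolding mid_mirror using ins by simp
      show "mid (\<lambda>x. - F X (- x)) (\<lambda>k. - cut X (- (k + g X))) (- cut Z (- (j + g Z)))" for j
        unfolding mid_mirror using ins by simp
      show "- F Z (- (- cut Y (- (- k - 1 + g Y)))) \<le> - F Z (- (- cut Z (- (- k - 1 + g Z)))) + 1/4"
        using half g by (simp add: algebra_simps)
      show "- cut Z (- (- k - 1 + g Z)) \<le> - cut Y (- (- k - 1 + g Y))"
        using False g by simp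
    qed
  qed
qed

text \<open>A change of order would nest the arc of \<open>C\<close> after \<open>cut C k\<close> in
  an arc of \<open>B\<close>. A start at \<open>cut C k\<close> then gives \<open>C\<close> all
  arcs, \<open>B\<close> the deficit allowed for \<open>W\<close>, and \<open>A\<close> the missing
  arc with \<open>k = 1\<close>.\<close>

lemma same_order:
  assumes t: "trio A B C" and wB: "weave (cut A) (cut B)" and wC: "weave (cut A) (cut C)"
    and ins: "\<And>k. inside A (cut B k)" "\<And>k. inside A (cut C k)"
    and NN: "2 * N A < n" "N C > 0"
    and less: "cut B k < cut C k"
  shows "cut B (k + 1) < cut C (k + 1)"
proof (rule ccontr)
  assume c: "\<not> ?thesis"
  have x: "F A (cut B j) + 1/4 < F A (cut A (j + 1))" "F A (cut C j) + 1/4 < F A (cut A (j + 1))" for j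
    using weave_right(2)[OF wB ins(1)] weave_right(2)[OF wC ins(2)] by auto
  show False
  proof (rule knife_stuck[of C B A "cut C k" "\<lambda>i. cut C (k + int i)" "\<lambda>i. cut B (k + int i)"
      "\<lambda>i. cut A (k + 1 + int i)" 1 1])
    show "cut A (k + 1 + int (n - 1)) \<le> cut C k + m"
      unfolding period_pred using weaveD(1)[OF wC, of k] by simp
    show "F A (cut C k) + real 1 / 4 \<le> F A (cut A (k + 1 + int 0))" using x(2)[of k] by simp
    show "1 = (0::nat) \<or> 1 = (1::nat) \<and> (\<forall>i<n. F A (cut C (k + int i)) + 1/4 \<le> F A (cut A (k + 1 + int i))) \<and>
       (N A < N C + 1 \<or> (\<forall>i<n. F A (cut B (k + int i)) + 1/4 \<le> F A (cut A (k + 1 + int i))))"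
    proof (intro disjI2 conjI allI impI)
      fix i
      show "F A (cut C (k + int i)) + 1/4 \<le> F A (cut A (k + 1 + int i))"
        using x(2)[of "k + int i"] by (simp add: algebra_simps)
      show "F A (cut B (k + int i)) + 1/4 \<le> F A (cut A (k + 1 + int i))"
        using x(1)[of "k + int i"] by (simp add: algebra_simps)
    qed simp
    show "F C (cut C (k + int i)) + 3/4 \<le> F C (cut C (k + int (Suc i)))" for i by (rule gap_nat')
    show "F B (cut B (k + int i)) + 3/4 \<le> F B (cut B (k + int (Suc i)))" for i by (rule gap_nat')
    show "(1::nat) \<le> 2 \<and> (\<forall>i<n - 1. F A (cut A (k + 1 + int i)) + 1 \<le> F A (cut A (k + 1 + int (Suc i)))) \<or>
      1 = (3::nat) \<and> (\<forall>i<n - 1. F A (cut A (k + 1 + int i)) + 3/4 \<le> F A (cut A (k + 1 + int (Suc i))))"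
      by (intro disjI1 conjI allI impI gap_nat) simp
    show "cut C k \<le> cut A (k + 1 + int 0)" using weaveD(2)[OF wC, of k] by simp
  qed (use trioD[OF t] NN period c less in auto)
qed

end

section \<open>Arcs that are bad for another type\<close>

text \<open>The cyclic successor maps the indices with \<open>P\<close> injectively to indices
  without \<open>P\<close>.\<close>

lemma half_card:
  fixes P :: "nat \<Rightarrow> bool"
  assumes "P n = P 0" "\<And>i. \<not> (P i \<and> P (Suc i))"
  shows "n \<le> 2 * card {i. i < n \<and> \<not> P i}"
proof -
  define f where "f i = (if Suc i = n then 0 else Suc i)" for i
  have "card {i. i < n \<and> P i} \<le> card {i. i < n \<and> \<not> P i}"
  proof (rule card_inj_on_le)
    show "inj_on f {i. i < n \<and> P i}" by (rule inj_onI) (auto simp: f_def split: if_splits)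
    show "f ` {i. i < n \<and> P i} \<subseteq> {i. i < n \<and> \<not> P i}"
    proof
      fix y assume "y \<in> f ` {i. i < n \<and> P i}"
      then obtain i where i: "i < n" "P i" "y = f i" by auto
      have "\<not> P (Suc i)" using assms(2)[of i] i by auto
      then show "y \<in> {i. i < n \<and> \<not> P i}" using i assms(1) by (auto simp: f_def)
    qed
  qed simp
  moreover have "{..<n} = {i. i < n \<and> P i} \<union> {i. i < n \<and> \<not> P i}" by auto
  then have "n = card {i. i < n \<and> P i} + card {i. i < n \<and> \<not> P i}"
    by (metis (no_types, lifting) card_Un_disjoint card_lessThan finite_Un finite_lessThan
        Int_emptyI mem_Collect_eq)
  ultimately show ?thesis by linarith
qed

text \<open>Hall's theorem for two demands. \<open>S\<close> takes elements outside \<open>H\<close>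
  first and enters \<open>G \<inter> H\<close> only once \<open>G - H\<close> is exhausted; in that
  case \<open>S\<close> and the rest of \<open>H\<close> together make up
  \<open>G \<union> H\<close>.\<close>

lemma two_representatives:
  assumes fin: "finite G" "finite H" and "b \<le> card G" "c \<le> card H" "b + c \<le> card (G \<union> H)"
  obtains S T where "S \<subseteq> G" "T \<subseteq> H" "S \<inter> T = {}" "card S = b" "card T = c"
proof (cases "b \<le> card (G - H)")
  case True
  then obtain S where "S \<subseteq> G - H" "card S = b" using obtain_subset_with_card_n by metis
  moreover obtain T where "T \<subseteq> H" "card T = c" using obtain_subset_with_card_n assms(4) by metis
  ultimately show ?thesis using that[of S T] by blast
next
  case False
  have GG: "card G = card (G - H) + card (G \<inter> H)"
    using card_Int_Diff[OF fin(1), of H] by simp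
  then have "b - card (G - H) \<le> card (G \<inter> H)" using assms(3) by linarith
  then obtain U where U: "U \<subseteq> G \<inter> H" "card U = b - card (G - H)"
    using obtain_subset_with_card_n by metis
  have finU: "finite U" using U(1) fin finite_subset by (metis finite_Int)
  have "card ((G - H) \<union> U) = card (G - H) + card U"
    using U(1) fin finU by (intro card_Un_disjoint) auto
  then have S: "card ((G - H) \<union> U) = b" using U False by simp
  have "card (G \<union> H) = card (G - H) + card H"
    using card_Un_disjoint[of "G - H" H] fin by (simp add: Int_commute)
  moreover have "card (H - U) = card H - card U" using U(1) finU by (intro card_Diff_subset) auto
  ultimately have "c \<le> card (H - U)" using assms(5) U(2) False by linarith
  then obtain T where "T \<subseteq> H - U" "card T = c" using obtain_subset_with_card_n by metis
  then show ?thesis using that[of "(G - H) \<union> U" T] U(1) S by blast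
qed

lemma sum_shift_one:
  fixes f :: "int \<Rightarrow> nat"
  assumes "f p = f 0" "p > 0"
  shows "(\<Sum>k\<in>{0..<p}. f (k + 1)) = (\<Sum>k\<in>{0..<p}. f k)"
proof -
  have "(\<Sum>k\<in>{0..<p}. f (k + 1)) = (\<Sum>k\<in>{1..<p + 1}. f k)"
    by (rule sum.reindex_bij_witness[of _ "\<lambda>k. k - 1" "\<lambda>k. k + 1"]) auto
  also have "{1..<p + 1} = insert p {1..<p}" using assms(2) by auto
  also have "(\<Sum>k\<in>insert p {1..<p}. f k) = (\<Sum>k\<in>insert 0 {1..<p}. f k)" using assms(1) by simp
  also have "insert 0 {1..<p} = {0..<p}" using assms(2) by auto
  finally show ?thesis .
qed

lemma sum_shift:
  fixes f :: "int \<Rightarrow> nat"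
  assumes "\<And>k. f (k + p) = f k" "p > 0"
  shows "(\<Sum>k\<in>{0..<p}. f (k + int i)) = (\<Sum>k\<in>{0..<p}. f k)"
proof (induction i)
  case (Suc i)
  have "f (p + int i) = f (0 + int i)" using assms(1)[of "int i"] by (simp add: add.commute)
  then show ?case using sum_shift_one[of "\<lambda>k. f (k + int i)" p] assms(2) Suc
    by (simp add: algebra_simps)
qed simp

lemma spread_card:
  fixes P :: "int \<Rightarrow> bool"
  assumes "\<And>k. P (k + p) = P k" "p > 0"
    "\<And>k. \<not> (P k \<and> P (k + 2))" "\<And>k. \<not> (P k \<and> P (k + 3))" "\<And>k. \<not> (P k \<and> P (k + 5))"
  shows "3 * card ({0..<p} \<inter> {k. P k}) \<le> nat p"
proof -
  \<comment> \<open>the translates of \<open>{0, 2, 5}\<close> by elements of \<open>P\<close> are pairwise disjoint\<close>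
  define f where "f k = (if P k then 1 else 0 :: nat)" for k
  have f: "f (k + p) = f k" for k using assms(1) by (simp add: f_def)
  have "f k + f (k + 2) + f (k + 5) \<le> 1" for k
  proof -
    have "\<not> (P (k + 2) \<and> P (k + 5))" using assms(4)[of "k + 2"] by (simp add: algebra_simps)
    then show ?thesis using assms(3)[of k] assms(5)[of k] by (auto simp: f_def)
  qed
  then have "(\<Sum>k\<in>{0..<p}. f k + f (k + 2) + f (k + 5)) \<le> (\<Sum>k\<in>{0..<p}. 1)" by (intro sum_mono) simp
  moreover have "(\<Sum>k\<in>{0..<p}. f (k + 2)) = (\<Sum>k\<in>{0..<p}. f k)" "(\<Sum>k\<in>{0..<p}. f (k + 5)) = (\<Sum>k\<in>{0..<p}. f k)"
    using sum_shift[of f p 2, OF f assms(2)] sum_shift[of f p 5, OF f assms(2)] by simp_all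
  moreover have "(\<Sum>k\<in>{0..<p}. f k) = card ({0..<p} \<inter> {k. P k})"
    by (simp add: f_def sum.If_cases)
  ultimately show ?thesis by (simp add: sum.distrib)
qed

section \<open>Arcs of one type as seen by another\<close>

context cake
begin

definition poor :: "'a \<Rightarrow> 'a \<Rightarrow> int \<Rightarrow> bool" where
  "poor X Y k \<longleftrightarrow> F Y (cut X (k + 1)) < F Y (cut X k) + 3/4"

lemma poor_period: "poor X Y (k + int n) = poor X Y k"
proof -
  have "cut X (k + int n + 1) = cut X (k + 1) + m" using period[of X "k + 1"] by (simp add: algebra_simps)
  then show ?thesis unfolding poor_def period
    using F_period[of Y "cut X (k + 1)" "cut X k"] by auto
qed

text \<open>Two consecutive arcs of \<open>X\<close> contain a whole arc of \<open>Y\<close> and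
  more than 1/4 on either side of it. For \<open>Y\<close> they are worth more than 3/2 together, so
  one of them is worth more than 3/4.\<close>

lemma poor_apart:
  assumes w: "weave (cut X) (\<lambda>k. cut Y (k + g))" and ins: "\<And>k. inside Y (cut X k)"
  shows "\<not> (poor X Y k \<and> poor X Y (k + 1))"
proof -
  have l: "F Y (cut X k) + 1/4 < F Y (cut Y (k + g))"
    using mid_at(2)[OF ins[of k], of "k + g - 1"] weaveD[OF w, of k] weaveD[OF w, of "k - 1"]
    by (simp add: algebra_simps)
  have r: "F Y (cut Y (k + g + 1)) + 1/4 < F Y (cut X (k + 1 + 1))"
    using mid_at(1)[OF ins[of "k + 1 + 1"], of "k + g + 1"] weaveD[OF w, of "k + 1"] weaveD[OF w, of "k + 1 + 1"]
    by (simp add: algebra_simps)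
  show ?thesis using l r gap[of Y "k + g"] unfolding poor_def by argo
qed

lemma poor_half:
  assumes "\<And>k. \<not> (poor X Y k \<and> poor X Y (k + 1))"
  shows "n \<le> 2 * card {i. i < n \<and> \<not> poor X Y (int i)}"
proof (rule half_card[of "\<lambda>i. poor X Y (int i)"])
  show "poor X Y (int n) = poor X Y (int 0)" using poor_period[of X Y 0] by simp
  show "\<not> (poor X Y (int i) \<and> poor X Y (int (Suc i)))" for i
    using assms[of "int i"] by (simp add: algebra_simps)
qed

end

context stuck
begin

text \<open>Otherwise the arcs of \<open>X\<close> can be matched: \<open>poor_half\<close> provides
  enough arcs for \<open>Y\<close> and for \<open>Z\<close> separately, and few arcs poor for both
  means enough arcs for the two jointly. The remaining arcs go to \<open>X\<close>, which accepts
  any of them.\<close>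

lemma many_poor:
  assumes t: "trio X Y Z" and Y: "\<And>k. \<not> (poor X Y k \<and> poor X Y (k + 1))" "2 * N Y \<le> n"
    and Z: "\<And>k. N Z > 0 \<Longrightarrow> \<not> (poor X Z k \<and> poor X Z (k + 1))" "2 * N Z \<le> n"
  shows "N X < card {i. i < n \<and> poor X Y (int i) \<and> poor X Z (int i)}" (is "_ < card ?B")
proof (rule ccontr)
  assume few: "\<not> ?thesis"
  let ?G = "{i. i < n \<and> \<not> poor X Y (int i)}" and ?H = "{i. i < n \<and> \<not> poor X Z (int i)}"
  have NN: "N X + N Y + N Z = n"
    using total unfolding trioD(1)[OF t] using trioD(2-4)[OF t] by simp
  have "card (?G \<union> ?H) + card ?B = card (?G \<union> ?H \<union> ?B)" by (subst card_Un_disjoint) auto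
  also have "?G \<union> ?H \<union> ?B = {..<n}" by auto
  finally have c: "N Y + N Z \<le> card (?G \<union> ?H)" using few NN by simp
  have b: "N Y \<le> card ?G" using poor_half[OF Y(1)] Y(2) by simp
  have d: "N Z \<le> card ?H"
  proof (cases "N Z > 0")
    case True
    show ?thesis using poor_half[OF Z(1)[OF True]] Z(2) by linarith
  qed simp
  have "finite ?G" "finite ?H" by simp_all
  then obtain S T where ST: "S \<subseteq> ?G" "T \<subseteq> ?H" "S \<inter> T = {}" "card S = N Y" "card T = N Z"
    using b d c by (rule two_representatives)
  have fin: "finite S" "finite T" using finite_subset[OF ST(1)] finite_subset[OF ST(2)] by auto
  define g where "g i = (if i \<in> S then Y else if i \<in> T then Z else X)" for i
  have "deals F (cut X 0 + m) N (cut X (0 + int 0))"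
  proof (rule deals_seq[where r = n and q = "\<lambda>i. cut X (0 + int i)" and g = g])
    fix i assume "i < n"
    show "F (g i) (cut X (0 + int i)) + 3/4 \<le> F (g i) (cut X (0 + int (Suc i)))"
      using gap_nat'[of X 0 i] ST(1,2) unfolding g_def poor_def by (auto simp: algebra_simps)
  next
    fix v
    have "{i. i < n \<and> g i = Y} = S" "{i. i < n \<and> g i = Z} = T" "{i. i < n \<and> g i = X} = {..<n} - (S \<union> T)"
      using ST(1-3) trioD[OF t] by (auto simp: g_def split: if_splits)
    moreover have "card ({..<n} - (S \<union> T)) = n - (N Y + N Z)"
      using ST fin by (subst card_Diff_subset) (auto simp: card_Un_disjoint)
    ultimately show "N v = card {i. i < n \<and> g i = v}"
      using trio_cases[OF t, of v] ST NN by auto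
  qed (use period[of X 0] in auto)
  then show False using stuck by simp
qed

text \<open>By \<open>many_poor\<close> more than \<open>N A\<close>, hence more than half, of the
  arcs of \<open>A\<close> would be poor for \<open>B\<close>, but poor arcs are never
  consecutive.\<close>

lemma large_type_contra:
  assumes t: "trio A B C" and "n \<le> 2 * N A" and B: "\<And>k. \<not> (poor A B k \<and> poor A B (k + 1))"
    and C: "\<And>k. N C > 0 \<Longrightarrow> \<not> (poor A C k \<and> poor A C (k + 1))"
  shows False
proof -
  have "N A + N B + N C = n"
    using total unfolding trioD(1)[OF t] using trioD(2-4)[OF t] by simp
  then have "N A < card {i. i < n \<and> poor A B (int i) \<and> poor A C (int i)}"
    using assms(2) by (intro many_poor[OF t B _ C]) simp_all
  also have "\<dots> \<le> card {i. i < n \<and> poor A B (int i)}" by (rule card_mono) auto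
  finally have "n < 2 * card {i. i < n \<and> poor A B (int i)}" using assms(2) by simp
  moreover have "{..<n} = {i. i < n \<and> poor A B (int i)} \<union> {i. i < n \<and> \<not> poor A B (int i)}" by auto
  then have "n = card {i. i < n \<and> poor A B (int i)} + card {i. i < n \<and> \<not> poor A B (int i)}"
    by (metis (no_types, lifting) card_Un_disjoint card_lessThan finite_Un finite_lessThan
        Int_emptyI mem_Collect_eq)
  ultimately show False using poor_half[OF B] by simp
qed

end

section \<open>Three alternating cut systems\<close>

context stuck
begin

text \<open>\<open>T\<close> takes the first piece, then \<open>knife\<close> serves the other
  \<open>n - 1\<close> agents with \<open>d = 1\<close> and \<open>k = 1\<close>. Its count
  \<open>2 * (N T - 1) + 2 \<le> (n - 1) + 1\<close> is exactly
  \<open>2 * N T \<le> n\<close>.\<close>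

lemma knife_rest:
  assumes "UNIV = {S, W, T}" "S \<noteq> W" "S \<noteq> T" "W \<noteq> T"
    and "N T > 0" "2 * N T \<le> n" and "p \<le> p'" "p' \<le> p + m" "F T p + 3/4 \<le> F T p'"
    and "p' \<le> s 0" "s (n - 1) \<le> p + m" "\<And>i. F S (s i) + 3/4 \<le> F S (s (Suc i))"
    and "p' \<le> w 0" "w (n - 1) \<le> p + m" "\<And>i. F W (w i) + 3/4 \<le> F W (w (Suc i))"
    and "p' \<le> t 0" "t (n - 2) \<le> p + m" "\<And>i. F T (t i) + 1 \<le> F T (t (Suc i))"
    and "F T p' + 1/4 \<le> F T (t 0)"
    and "\<And>i. F T (s i) + 1/4 \<le> F T (t i)" "\<And>i. F T (w i) + 1/4 \<le> F T (t i)"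
  shows False
proof -
  have "sum N UNIV = N S + N W + N T"
    unfolding assms(1) using assms(2-4) by simp
  then have NN: "N S + N W + N T = n" using total by simp
  have "deals F (p + m) (N(T := N T - 1)) p'"
    by (rule knife[OF mono assms(1-4), where R = "n - 1" and s = s and w = w and t = t and d = 1 and k = 1])
       (use assms(2-) NN in \<open>auto simp: numeral_2_eq_2\<close>)
  from deals.serve[where F = F and N = N, OF assms(5,7,9) this] show False using stuck by simp
qed

lemma three_woven_contra:
  assumes t: "trio A B C" and NA: "N B \<le> N A" "N C \<le> N A" "2 * N A < n"
    and pos: "N B > 0" "N C > 0"
    and wB: "weave (cut A) (cut B)" and wC: "weave (cut A) (cut C)"
    and BC: "\<And>k. cut B k < cut C k"
    and ins: "\<And>X Y k. X \<noteq> Y \<Longrightarrow> inside X (cut Y k)"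
  shows False
proof -
  \<comment> \<open>All cuts are merged into one increasing sequence \<open>z\<close>, whose types
    repeat in the order \<open>A\<close>, \<open>B\<close>, \<open>C\<close>. An arc of one type
    runs from \<open>z k\<close> to \<open>z (k + 3)\<close>, and one turn has \<open>3 * n\<close>
    cuts.\<close>
  define ty where "ty k = (if k mod 3 = 0 then A else if k mod 3 = 1 then B else C)" for k :: int
  define z where "z k = cut (ty k) (k div 3)" for k
  have ty3: "ty (k + 3) = ty k" for k by (simp add: ty_def)
  have mod3: "k mod 3 = 0 \<or> k mod 3 = 1 \<or> k mod 3 = 2" for k :: int by presburger
  have ty_rot: "trio (ty k) (ty (k + 1)) (ty (k + 2))" for k
  proof -
    have m: "(k + 1) mod 3 = (k mod 3 + 1) mod 3" "(k + 2) mod 3 = (k mod 3 + 2) mod 3" by presburger+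
    show ?thesis using mod3[of k] t unfolding ty_def m trio_def by auto
  qed
  have z3: "z (k + 3) = cut (ty k) (k div 3 + 1)" for k by (simp add: z_def ty3)
  have z_gap: "F (ty k) (z k) + 1 \<le> F (ty k) (z (k + 3))" for k
    unfolding z3 unfolding z_def[of k] by (rule gap)
  have z_period: "z (k + 3 * int i) = cut (ty k) (k div 3 + int i)" for k i
  proof -
    have "(k + 3 * int i) mod 3 = k mod 3" by (rule mod_mult_self2)
    then have "ty (k + 3 * int i) = ty k" by (simp add: ty_def)
    moreover have "(k + 3 * int i) div 3 = k div 3 + int i" by simp
    ultimately show ?thesis unfolding z_def by (simp only:)
  qed
  have z_m: "z (k + 3 * int n) = z k + m" for k unfolding z_period period unfolding z_def ..
  have z_step: "z k < z (k + 1)" for k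
  proof -
    have "k mod 3 = 0 \<and> (k + 1) mod 3 = 1 \<and> (k + 1) div 3 = k div 3 \<or>
      k mod 3 = 1 \<and> (k + 1) mod 3 = 2 \<and> (k + 1) div 3 = k div 3 \<or>
      k mod 3 = 2 \<and> (k + 1) mod 3 = 0 \<and> (k + 1) div 3 = k div 3 + 1" by presburger
    then show ?thesis
      using weaveD(1)[OF wB, of "k div 3"] BC[of "k div 3"] weaveD(2)[OF wC, of "k div 3"]
      by (elim disjE conjE) (simp_all add: z_def ty_def)
  qed
  have z_le: "z j \<le> z (j + int i)" for j i
  proof (induction i)
    case (Suc i)
    then show ?case using z_step[of "j + int i"] by (simp add: algebra_simps)
  qed simp
  have z_mono: "i \<le> j \<Longrightarrow> z i \<le> z j" for i j using z_le[of i "nat (j - i)"] by simp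
  have tyq: "ty i = ty j" if "i mod 3 = j mod 3" for i j using that by (simp add: ty_def)
  have z_in: "F (ty j) (z j) + 1/4 < F (ty j) (z k) \<and> F (ty j) (z k) + 1/4 < F (ty j) (z (j + 3))"
    if "k = j + 1 \<or> k = j + 2" for j k
  proof -
    have "ty k \<noteq> ty j" using that trioD(2,3)[OF ty_rot[of j]] by auto
    then have i: "inside (ty j) (z k)" unfolding z_def by (intro ins) auto
    have "cut (ty j) (j div 3) \<le> z k" "z k \<le> cut (ty j) (j div 3 + 1)"
      unfolding z3[symmetric] z_def[of j, symmetric] using that by (auto intro!: z_mono)
    from mid_at[OF i this] show ?thesis unfolding z3 z_def[of j] by blast
  qed
  have lo: "F (ty i) (z j) + 1/4 < F (ty i) (z k)" if "k = j + 1 \<or> k = j + 2" "i mod 3 = j mod 3" for i j k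
    unfolding tyq[OF that(2)] by (rule conjunct1[OF z_in[OF that(1)]])
  have hi: "F (ty i) (z k) + 1/4 < F (ty i) (z l)" if "l = k + 1 \<or> l = k + 2" "i mod 3 = l mod 3" for i k l
  proof -
    have "k = l - 3 + 1 \<or> k = l - 3 + 2" using that(1) by linarith
    moreover have "i mod 3 = (l - 3) mod 3" using that(2) by (simp only: minus_mod_self2)
    ultimately show ?thesis using z_in tyq diff_add_cancel by metis
  qed
  have gp: "F (ty i) (z j) + 1 \<le> F (ty i) (z l)" if "l = j + 3" "i mod 3 = j mod 3" for i j l
    unfolding tyq[OF that(2)] that(1) by (rule z_gap)
  define bad where "bad k \<longleftrightarrow> F (ty (k + 1)) (z (k + 3)) < F (ty (k + 1)) (z k) + 3/4 \<and>
      F (ty (k + 2)) (z (k + 3)) < F (ty (k + 2)) (z k) + 3/4" for k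
  have badD: "F (ty i) (z l) < F (ty i) (z k) + 3/4"
    if "bad k" "l = k + 3" "i mod 3 = (k + 1) mod 3 \<or> i mod 3 = (k + 2) mod 3" for i k l
    using that(3)
  proof
    assume "i mod 3 = (k + 1) mod 3"
    from tyq[OF this] show ?thesis using that(1,2) unfolding bad_def by (simp only:)
  next
    assume "i mod 3 = (k + 2) mod 3"
    from tyq[OF this] show ?thesis using that(1,2) unfolding bad_def by (simp only:)
  qed
  \<comment> \<open>The type of \<open>k + 1\<close> finds more than 1/4 of a bad arc before its cut
    \<open>z (k + 1)\<close>, so less than 1/2 after it; its own arc then has more than 1/2 left
    between \<open>z (k + 3)\<close> and \<open>z (k + 4)\<close>.\<close>
  have next_half1: "F (ty i) (z a) < F (ty i) (z b) + 1/2"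
    if "bad k" "i mod 3 = (k + 1) mod 3" "a = k + 3" "b = k + 1" for i k a b
  proof -
    have "F (ty i) (z k) + 1/4 < F (ty i) (z b)" by (rule hi) (use that(2-) in presburger)+
    then show ?thesis using badD[OF that(1,3) disjI1[OF that(2)]] by linarith
  qed
  have next_half2: "F (ty i) (z a) + 1/2 < F (ty i) (z b)"
    if "bad k" "i mod 3 = (k + 1) mod 3" "a = k + 3" "b = k + 4" for i k a b
  proof -
    have "F (ty i) (z (k + 1)) + 1 \<le> F (ty i) (z b)" by (rule gp) (use that(2-) in presburger)+
    then show ?thesis using next_half1[OF that(1-3) refl] by linarith
  qed
  \<comment> \<open>The symmetric estimates at the left end, for the type whose cut is
    \<open>z (k + 2)\<close>.\<close>
  have prev_half1: "F (ty i) (z b) < F (ty i) (z k) + 1/2"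
    if "bad k" "i mod 3 = (k + 2) mod 3" "b = k + 2" for i k b
  proof -
    have "F (ty i) (z b) + 1/4 < F (ty i) (z (k + 3))" by (rule lo) (use that(2-) in presburger)+
    then show ?thesis using badD[OF that(1) refl disjI2[OF that(2)]] by linarith
  qed
  have prev_half2: "F (ty i) (z b) + 1/2 < F (ty i) (z k)"
    if "bad k" "i mod 3 = (k + 2) mod 3" "b = k - 1" for i k b
  proof -
    have "F (ty i) (z b) + 1 \<le> F (ty i) (z (k + 2))" by (rule gp) (use that(2-) in presburger)+
    then show ?thesis using prev_half1[OF that(1,2) refl] by linarith
  qed
  \<comment> \<open>For the type of \<open>k + 1\<close>, the overlapping stretches from
    \<open>z (k + 1)\<close> to \<open>z (k + 3)\<close> and from \<open>z (k + 2)\<close> to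
    \<open>z (k + 4)\<close> are worth less than 1/2 each, yet they cover one of its arcs.\<close>
  have bad2: "\<not> (bad k \<and> bad (k + 2))" for k
  proof
    assume b: "bad k \<and> bad (k + 2)"
    have "F (ty (k + 1)) (z (k + 4)) < F (ty (k + 1)) (z (k + 2)) + 1/2"
      by (rule prev_half1[OF conjunct2[OF b]]) presburger+
    moreover have "F (ty (k + 1)) (z (k + 2)) \<le> F (ty (k + 1)) (z (k + 3))" by (intro le_F z_mono) simp
    moreover have "F (ty (k + 1)) (z (k + 3)) < F (ty (k + 1)) (z (k + 1)) + 1/2"
      by (rule next_half1[OF conjunct1[OF b]]) presburger+
    moreover have "F (ty (k + 1)) (z (k + 1)) + 1 \<le> F (ty (k + 1)) (z (k + 4))" by (rule gp) presburger+
    ultimately show False by linarith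
  qed
  \<comment> \<open>The type of \<open>k + 1\<close> finds more than 1/2 before
    \<open>z (k + 4)\<close> and more than 1/4 after it within the arc from \<open>z (k + 3)\<close>
    to \<open>z (k + 6)\<close>, so this arc is not bad.\<close>
  have bad3: "\<not> (bad k \<and> bad (k + 3))" for k
  proof
    assume b: "bad k \<and> bad (k + 3)"
    have "F (ty (k + 1)) (z (k + 4)) + 1/4 < F (ty (k + 1)) (z (k + 6))" by (rule lo) presburger+
    moreover have "F (ty (k + 1)) (z (k + 6)) < F (ty (k + 1)) (z (k + 3)) + 3/4"
      by (rule badD[OF conjunct2[OF b]]) presburger+
    moreover have "F (ty (k + 1)) (z (k + 3)) + 1/2 < F (ty (k + 1)) (z (k + 4))"
      by (rule next_half2[OF conjunct1[OF b]]) presburger+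
    ultimately show False by linarith
  qed
  have bad5: "\<not> (bad k \<and> bad (k + 5))" for k
  proof
    assume b: "bad k \<and> bad (k + 5)"
    \<comment> \<open>The piece from \<open>z (k + 3)\<close> to \<open>z (k + 5)\<close> is worth
      more than 1 to \<open>?T\<close>. It starts at a cut of \<open>ty k\<close> and ends at one of
      \<open>ty (k + 2)\<close>, so these two types keep \<open>n - 1\<close> arcs for the remaining
      \<open>n - 1\<close> agents. Only \<open>?T\<close> lacks an arc, and it has more than 1/4
      left before \<open>z (k + 7)\<close>.\<close>
    let ?T = "ty (k + 1)"
    have "F ?T (z (k + 4)) + 1/2 < F ?T (z (k + 5))"
      by (rule prev_half2[OF conjunct2[OF b]]) presburger+
    moreover have "F ?T (z (k + 3)) + 1/2 < F ?T (z (k + 4))"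
      by (rule next_half2[OF conjunct1[OF b]]) presburger+
    ultimately have short: "F ?T (z (k + 3)) + 3/4 \<le> F ?T (z (k + 5))" by linarith
    have n2: "n \<ge> 2" using NA pos by linarith
    have ends: "k + 5 + 3 * int (n - 1) = (k + 2) + 3 * int n" "k + 6 + 3 * int (n - 1) = (k + 3) + 3 * int n"
       "k + 7 + 3 * int (n - 2) = (k + 1) + 3 * int n" using n2 by auto
    have Tle: "N ?T \<le> N A" "N ?T > 0" using NA pos trio_cases[OF t, of ?T] by auto
    have inter: "F ?T (z (k + 5 + 3 * int i)) + 1/4 < F ?T (z (k + 7 + 3 * int i))"
      "F ?T (z (k + 6 + 3 * int i)) + 1/4 < F ?T (z (k + 7 + 3 * int i))" for i
      by (rule hi; presburger)+
    have gaps: "F (ty (k + 2)) (z (k + 5 + 3 * int i)) + 1 \<le> F (ty (k + 2)) (z (k + 5 + 3 * int (Suc i)))"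
      "F (ty k) (z (k + 6 + 3 * int i)) + 1 \<le> F (ty k) (z (k + 6 + 3 * int (Suc i)))"
      "F ?T (z (k + 7 + 3 * int i)) + 1 \<le> F ?T (z (k + 7 + 3 * int (Suc i)))" for i
      by (rule gp; simp add: algebra_simps; presburger)+
    show False
    proof (rule knife_rest[of "ty (k + 2)" "ty k" ?T "z (k + 3)" "z (k + 5)"
          "\<lambda>i. z (k + 5 + 3 * int i)" "\<lambda>i. z (k + 6 + 3 * int i)" "\<lambda>i. z (k + 7 + 3 * int i)"])
      show "UNIV = {ty (k + 2), ty k, ?T}" using trioD(1)[OF ty_rot[of k]] by auto
      show "ty (k + 2) \<noteq> ty k" "ty (k + 2) \<noteq> ?T" "ty k \<noteq> ?T" using trioD[OF ty_rot[of k]] by auto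
      show "z (k + 3) \<le> z (k + 5)" by (rule z_mono) simp
      show "z (k + 5) \<le> z (k + 3) + m" unfolding z_m[symmetric] using n2 by (intro z_mono) simp
      show "z (k + 5 + 3 * int (n - 1)) \<le> z (k + 3) + m" "z (k + 6 + 3 * int (n - 1)) \<le> z (k + 3) + m"
        "z (k + 7 + 3 * int (n - 2)) \<le> z (k + 3) + m"
        unfolding ends z_m by (simp_all add: z_mono)
      show "F (ty (k + 2)) (z (k + 5 + 3 * int i)) + 3/4 \<le> F (ty (k + 2)) (z (k + 5 + 3 * int (Suc i)))" for i
        using gaps(1)[of i] by linarith
      show "F (ty k) (z (k + 6 + 3 * int i)) + 3/4 \<le> F (ty k) (z (k + 6 + 3 * int (Suc i)))" for i
        using gaps(2)[of i] by linarith
      show "F ?T (z (k + 7 + 3 * int i)) + 1 \<le> F ?T (z (k + 7 + 3 * int (Suc i)))" for i by (rule gaps(3))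
      show "F ?T (z (k + 5)) + 1/4 \<le> F ?T (z (k + 7 + 3 * int 0))" using inter(1)[of 0] by simp
      show "F ?T (z (k + 5 + 3 * int i)) + 1/4 \<le> F ?T (z (k + 7 + 3 * int i))"
        "F ?T (z (k + 6 + 3 * int i)) + 1/4 \<le> F ?T (z (k + 7 + 3 * int i))" for i
        using inter[of i] by linarith+
    qed (use Tle NA short in \<open>auto intro: z_mono\<close>)
  qed
  have bad_period: "bad (k + 3 * int n) = bad k" for k
  proof -
    have tyn: "ty (k + 3 * int n + 1) = ty (k + 1)" "ty (k + 3 * int n + 2) = ty (k + 2)"
      by (rule tyq; presburger)+
    have zn: "z (k + 3 * int n + 3) = z (k + 3) + m" using z_m[of "k + 3"] by (simp add: algebra_simps)
    have "F t (z (k + 3) + m) - F t (z k + m) = F t (z (k + 3)) - F t (z k)" for t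
      using F_period[of t "z (k + 3)" "z k"] by simp
    then show ?thesis unfolding bad_def tyn zn z_m by (smt (verit))
  qed
  have count: "N (ty r) < card {i. i < n \<and> bad (r + 3 * int i)}" if "r = 0 \<or> r = 1 \<or> r = 2" for r
  proof -
    have r0: "r div 3 = 0" using that by auto
    have p: "poor (ty r) Y (int i) \<longleftrightarrow> F Y (z (r + 3 * int i + 3)) < F Y (z (r + 3 * int i)) + 3/4" for Y i
      using z_period[of r "Suc i"] z_period[of r i] r0 by (simp add: poor_def algebra_simps)
    have b: "bad (r + 3 * int i) \<longleftrightarrow> poor (ty r) (ty (r + 1)) (int i) \<and> poor (ty r) (ty (r + 2)) (int i)" for i
    proof -
      have "ty (r + 3 * int i + 1) = ty (r + 1)" "ty (r + 3 * int i + 2) = ty (r + 2)"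
        by (rule tyq; presburger)+
      then show ?thesis unfolding bad_def p by (simp only:)
    qed
    have wv: "\<exists>g. weave (cut (ty r)) (\<lambda>k. cut Y (k + g))" if "Y \<noteq> ty r" for Y
    proof -
      have BA: "weave (cut B) (\<lambda>k. cut A (k + 1))" "weave (cut C) (\<lambda>k. cut A (k + 1))"
        using weaveD[OF wB] weaveD[OF wC] by (auto simp: weave_def)
      have "cut C k < cut B (k + 1)" for k
        using weaveD(2)[OF wC, of k] weaveD(1)[OF wB, of "k + 1"] by linarith
      then have bc: "weave (cut B) (\<lambda>k. cut C (k + 0))" "weave (cut C) (\<lambda>k. cut B (k + 1))"
        using BC by (simp_all add: weave_def)
      have ab: "weave (cut A) (\<lambda>k. cut B (k + 0))" "weave (cut A) (\<lambda>k. cut C (k + 0))" using wB wC by simp_all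
      show ?thesis
        using trio_cases[OF t, of Y] trio_cases[OF t, of "ty r"] that BA bc ab
        by (elim disjE) (simp_all only:, blast+)
    qed
    have apart: "\<not> (poor (ty r) Y k \<and> poor (ty r) Y (k + 1))" if "Y \<noteq> ty r" for Y k
      using wv[OF that] poor_apart[of "ty r" Y] ins[OF that] by blast
    have half: "2 * N Y \<le> n" for Y using NA trio_cases[OF t, of Y] by auto
    show ?thesis unfolding b
      using trioD[OF ty_rot[of r]] half apart by (intro many_poor[OF ty_rot[of r]]) auto
  qed
  have tys: "ty 0 = A" "ty 1 = B" "ty 2 = C" by (simp_all add: ty_def)
  \<comment> \<open>\<open>R r\<close> collects the bad indices with residue \<open>r\<close>. By
    \<open>count\<close> the three classes contain more than \<open>N A + N B + N C = n\<close>
    indices in total, while \<open>spread_card\<close> allows at most \<open>n\<close>.\<close>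
  define R where "R r = (\<lambda>i. r + 3 * int i) ` {i. i < n \<and> bad (r + 3 * int i)}" for r
  have cardR: "card (R r) = card {i. i < n \<and> bad (r + 3 * int i)}" for r
    unfolding R_def by (rule card_image) (auto intro: inj_onI)
  have finR: "finite (R r)" for r by (simp add: R_def)
  have disj: "R 0 \<inter> R 1 = {}" "(R 0 \<union> R 1) \<inter> R 2 = {}" unfolding R_def by (auto; presburger)+
  have "R 0 \<union> R 1 \<union> R 2 \<subseteq> {0..<3 * int n} \<inter> {k. bad k}" unfolding R_def by auto
  then have "card (R 0 \<union> R 1 \<union> R 2) \<le> card ({0..<3 * int n} \<inter> {k. bad k})" by (intro card_mono) auto
  moreover have "card (R 0 \<union> R 1 \<union> R 2) = card (R 0) + card (R 1) + card (R 2)"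
    using disj finR by (simp add: card_Un_disjoint)
  moreover have "3 * card ({0..<3 * int n} \<inter> {k. bad k}) \<le> nat (3 * int n)"
    by (rule spread_card) (use bad_period bad2 bad3 bad5 n_pos in auto)
  moreover have "N A + N B + N C = n"
    using total unfolding trioD(1)[OF t] using trioD(2-4)[OF t] by simp
  ultimately show False using count[of 0] count[of 1] count[of 2] cardR[of 0] cardR[of 1] cardR[of 2] tys by simp
qed

text \<open>If \<open>A\<close> has at least half of the agents, matching its arcs suffices.
  Otherwise all cuts are inside for the other types and the order of \<open>B\<close> and
  \<open>C\<close> never changes, so the cyclic order is \<open>A\<close>, \<open>B\<close>,
  \<open>C\<close> or \<open>A\<close>, \<open>C\<close>, \<open>B\<close>.\<close>

lemma woven_contra:
  assumes t: "trio A B C" and NA: "N C \<le> N B" "N B \<le> N A" "N C > 0"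
    and wB: "weave (cut A) (cut B)" and wC: "weave (cut A) (cut C)"
    and insB: "\<And>k. inside B (cut A k)" "\<And>k. inside A (cut B k)" and insC: "\<And>k. inside C (cut A k)"
  shows False
proof (cases "2 * N A < n")
  case False
  have "weave (cut A) (\<lambda>k. cut B (k + 0))" "weave (cut A) (\<lambda>k. cut C (k + 0))" using wB wC by simp_all
  from poor_apart[OF this(1) insB(1)] poor_apart[OF this(2) insC] False
  show False by (intro large_type_contra[OF t]) simp_all
next
  case True
  then have NB: "2 * N B < n" using NA by simp
  have insA: "inside A (cut C k)" for k by (rule inside_back[OF t wB wC insB(1) NA(2) NB])
  have t': "trio A C B" by (rule trio_perm(2)[OF t])
  have BC: "inside C (cut B k)" for k by (rule inside_other[OF t wB wC insB(2) insA insC True])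
  have CB: "inside B (cut C k)" for k by (rule inside_other[OF t' wC wB insA insB(2) insB(1) True])
  have ins: "inside X (cut Y k)" if "X \<noteq> Y" for X Y k
    using that trio_cases[OF t, of X] trio_cases[OF t, of Y] insB insC insA BC CB by (elim disjE) simp_all
  have step: "cut B (k + 1) < cut C (k + 1)" if "cut B k < cut C k" for k
    by (rule same_order[OF t wB wC insB(2) insA True NA(3) that])
  have ne: "cut B k \<noteq> cut C k" for k using BC[of k] not_mid_cut[of C k] by metis
  show False
  proof (cases "\<exists>k. cut B k < cut C k")
    case True
    then obtain k where k: "cut B k < cut C k" ..
    have up: "cut B (k + int i) < cut C (k + int i)" for i
    proof (induction i)
      case (Suc i)
      then show ?case using step[of "k + int i"] by (simp add: algebra_simps)
    qed (use k in simp)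
    have per: "cut t (j + int (n * i)) = cut t j + int i * m" for t j i
    proof (induction i)
      case (Suc i)
      have "j + int (n * Suc i) = j + int (n * i) + int n" by (simp add: algebra_simps)
      then have "cut t (j + int (n * Suc i)) = cut t (j + int (n * i)) + m" by (simp only: period)
      then show ?case using Suc by (simp add: algebra_simps)
    qed simp
    \<comment> \<open>\<open>same_order\<close> propagates only forwards. Adding whole turns to
      \<open>j\<close> leads beyond \<open>k\<close>, and periodicity carries the inequality
      back.\<close>
    have all: "cut B j < cut C j" for j
    proof -
      define i where "i = nat (k - j)"
      have "i \<le> n * i" using n_pos by simp
      then have "int i \<le> int (n * i)" by (simp only: of_nat_le_iff)
      then have "k \<le> j + int (n * i)" unfolding i_def by linarith
      then have "cut B (j + int (n * i)) < cut C (j + int (n * i))"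
        using up[of "nat (j + int (n * i) - k)"] by (simp del: of_nat_mult)
      then show ?thesis unfolding per by simp
    qed
    show False
      by (rule three_woven_contra[OF t NA(2) _ \<open>2 * N A < n\<close> _ NA(3) wB wC all ins]) (use NA in simp_all)
  next
    case False
    then have all: "cut C k < cut B k" for k using ne[of k] by (metis linorder_neqE)
    show False
      by (rule three_woven_contra[OF t' _ NA(2) \<open>2 * N A < n\<close> NA(3) _ wC wB all ins]) (use NA in simp_all)
  qed
qed

text \<open>Without agents of type \<open>C\<close>, type \<open>A\<close> has at least half of all
  agents. Otherwise \<open>2 * N B < n\<close>, which makes the cuts of \<open>C\<close> alternate
  with those of \<open>A\<close>; shifting their indices by \<open>g\<close> gives the form required
  by \<open>woven_contra\<close>.\<close>

lemma two_woven_contra: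
  assumes t: "trio A B C" and NA: "N C \<le> N B" "N B \<le> N A"
    and wB: "weave (cut A) (cut B)"
    and insB: "\<And>k. inside B (cut A k)" "\<And>k. inside A (cut B k)"
  shows False
proof (cases "N C > 0")
  case False
  have NN: "N A + N B + N C = n"
    using total unfolding trioD(1)[OF t] using trioD(2-4)[OF t] by simp
  have "weave (cut A) (\<lambda>k. cut B (k + 0))" using wB by simp
  from poor_apart[OF this insB(1)] False NN NA
  show False by (intro large_type_contra[OF t]) simp_all
next
  case True
  have NN: "N A + N B + N C = n"
    using total unfolding trioD(1)[OF t] using trioD(2-4)[OF t] by simp
  have NB: "2 * N B < n" "N A > 0" using NN NA True by simp_all
  have insC: "inside C (cut A k)" for k by (rule third_inside[OF t wB insB(1) NA(2) NB(1)])
  have "\<exists>g. weave (cut A) (\<lambda>k. cut C (k + g))"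
    using insC by (rule alternate) (rule third_no_nesting[OF t wB insB(1) NA(2) NB])
  then obtain g where g: "weave (cut A) (\<lambda>k. cut C (k + g))" ..
  define h where "h t = (if t = C then g else 0)" for t
  have h: "h A = 0" "h B = 0" "h C = g" using trioD[OF t] by (auto simp: h_def)
  interpret M: stuck F "\<lambda>t k. cut t (k + h t)" m n N by (rule stuck_shift)
  show False
  proof (rule M.woven_contra[OF t NA True])
    show "weave (\<lambda>k. cut A (k + h A)) (\<lambda>k. cut B (k + h B))" unfolding h using wB by simp
    show "weave (\<lambda>k. cut A (k + h A)) (\<lambda>k. cut C (k + h C))" unfolding h using g by simp
  qed (unfold mid_shift, auto intro: insB insC)
qed

lemma sorted_contra:
  assumes t: "trio A B C" and NA: "N C \<le> N B" "N B \<le> N A"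
  shows False
proof -
  have NN: "N A + N B + N C = n"
    using total unfolding trioD(1)[OF t] using trioD(2-4)[OF t] by simp
  have NC: "3 * N C \<le> n" "N A > 0" using NN NA n_pos by simp_all
  \<comment> \<open>A cut of \<open>A\<close> is never inside for \<open>A\<close>, so
    \<open>inside_either\<close> puts it inside for \<open>B\<close>, and vice versa.\<close>
  have insB: "inside B (cut A k)" "inside A (cut B k)" for k
    using inside_either[OF t NC(1), of "cut A k"] inside_either[OF t NC(1), of "cut B k"]
      not_mid_cut[of A k] not_mid_cut[of B k] by auto
  have "\<exists>g. weave (cut A) (\<lambda>k. cut B (k + g))"
    using insB(1) by (rule alternate) (rule no_nesting[OF t NC])
  then obtain g where g: "weave (cut A) (\<lambda>k. cut B (k + g))" ..
  define h where "h t = (if t = B then g else 0)" for t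
  have h: "h A = 0" "h B = g" "h C = 0" using trioD[OF t] by (auto simp: h_def)
  interpret M: stuck F "\<lambda>t k. cut t (k + h t)" m n N by (rule stuck_shift)
  show False
  proof (rule M.two_woven_contra[OF t NA])
    show "weave (\<lambda>k. cut A (k + h A)) (\<lambda>k. cut B (k + h B))" unfolding h using g by simp
  qed (unfold mid_shift, auto intro: insB)
qed

lemma three_types_contra:
  fixes A B C :: 'a
  assumes t: "trio A B C"
  shows False
proof -
  note p = trio_perm(2)[OF t] trio_perm(1)[OF t]
  note q = trio_perm(1)[OF p(1)] trio_perm(2)[OF p(2)]
  consider "N C \<le> N B" "N B \<le> N A" | "N B \<le> N C" "N C \<le> N A" | "N C \<le> N A" "N A \<le> N B"
    | "N B \<le> N A" "N A \<le> N C" | "N A \<le> N C" "N C \<le> N B" | "N A \<le> N B" "N B \<le> N C" by linarith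
  then show False
    using sorted_contra[OF t] sorted_contra[OF p(1)] sorted_contra[OF p(2)] sorted_contra[OF q(1)]
      sorted_contra[OF q(2)] sorted_contra[OF trio_perm(2)[OF q(1)]] by cases simp_all
qed

end

lemma (in cake) deals_exists:
  fixes A B C :: 'a
  assumes "trio A B C"
  shows "\<exists>p. deals F (p + m) N p"
proof (rule ccontr)
  assume "\<not> ?thesis"
  then interpret stuck F cut m n N by unfold_locales auto
  show False by (rule three_types_contra[OF assms])
qed

section \<open>Arcs of the cycle of goods\<close>

definition good_at :: "nat \<Rightarrow> int \<Rightarrow> nat" where
  "good_at m j = nat (j mod int m)"

definition arc :: "nat \<Rightarrow> int \<Rightarrow> int \<Rightarrow> nat set" where
  "arc m x y = good_at m ` {x..<y}"

lemma good_at_less: "m > 0 \<Longrightarrow> good_at m j < m"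
  by (simp add: good_at_def nat_less_iff)

lemma int_good_at: "m > 0 \<Longrightarrow> int (good_at m j) = j mod int m"
  by (simp add: good_at_def)

lemma good_at_period [simp]: "good_at m (j + int m * q) = good_at m j" "good_at m (j + int m) = good_at m j"
  by (simp_all add: good_at_def)

lemma good_at_nat [simp]: "g < m \<Longrightarrow> good_at m (int g) = g"
  by (simp add: good_at_def)

lemma good_at_Suc: "m > 0 \<Longrightarrow> Suc (good_at m j) mod m = good_at m (j + 1)"
  using int_good_at[of m j] int_good_at[of m "j + 1"]
  by (metis mod_add_left_eq of_nat_Suc of_nat_eq_iff zmod_int add.commute)

lemma good_at_inj:
  assumes "m > 0" "good_at m i = good_at m j" "\<bar>i - j\<bar> < int m"
  shows "i = j"
proof -
  have "i mod int m = j mod int m" using assms(1,2) by (metis int_good_at)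
  then have "int m dvd i - j" by (simp add: mod_eq_dvd_iff)
  then show ?thesis using assms(3) dvd_imp_le_int[of "i - j" "int m"] by force
qed

lemma arc_shift: "arc m (x + int m * q) (y + int m * q) = arc m x y"
proof -
  have "{x + int m * q..<y + int m * q} = (\<lambda>j. j + int m * q) ` {x..<y}" by simp
  then show ?thesis unfolding arc_def by (simp only: image_image good_at_period)
qed

lemma arc_full:
  assumes "m > 0"
  shows "arc m p (p + int m) = {..<m}"
proof
  show "arc m p (p + int m) \<subseteq> {..<m}" using good_at_less[OF assms] by (auto simp: arc_def)
  show "{..<m} \<subseteq> arc m p (p + int m)"
  proof
    fix g assume g: "g \<in> {..<m}"
    let ?j = "p + (int g - p) mod int m"
    have "?j mod int m = int g mod int m" by (simp add: mod_add_right_eq)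
    then have "good_at m ?j = g" using g by (simp add: good_at_def)
    moreover have "?j \<in> {p..<p + int m}" using assms by simp
    ultimately show "g \<in> arc m p (p + int m)" unfolding arc_def by (metis imageI)
  qed
qed

lemma bundle_arc:
  assumes "m > 0"
  shows "is_bundle m (arc m x y)"
  unfolding is_bundle_def
proof (intro conjI ballI)
  show "arc m x y \<subseteq> {..<m}" using good_at_less[OF assms] by (auto simp: arc_def)
  let ?R = "\<lambda>a b. a \<in> arc m x y \<and> b \<in> arc m x y \<and> cycle_adj m a b"
  have adj: "cycle_adj m (good_at m j) (good_at m (j + 1))" "cycle_adj m (good_at m (j + 1)) (good_at m j)" for j
    using good_at_less[OF assms] good_at_Suc[OF assms, of j] by (simp_all add: cycle_adj_def)
  have path: "?R\<^sup>*\<^sup>* (good_at m i) (good_at m (i + int k)) \<and> ?R\<^sup>*\<^sup>* (good_at m (i + int k)) (good_at m i)"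
    if "x \<le> i" "i + int k < y" for i k
    using that(2)
  proof (induction k)
    case (Suc k)
    have e: "i + int (Suc k) = i + int k + 1" by simp
    have "good_at m (i + int k) \<in> arc m x y" "good_at m (i + int k + 1) \<in> arc m x y"
      using that(1) Suc.prems by (auto simp: arc_def)
    then have R: "?R (good_at m (i + int k)) (good_at m (i + int k + 1))"
      "?R (good_at m (i + int k + 1)) (good_at m (i + int k))" using adj by auto
    have IH: "?R\<^sup>*\<^sup>* (good_at m i) (good_at m (i + int k))" "?R\<^sup>*\<^sup>* (good_at m (i + int k)) (good_at m i)"
      using Suc by auto
    show ?case unfolding e
      using rtranclp.rtrancl_into_rtrancl[where r = ?R, OF IH(1) R(1)]
        converse_rtranclp_into_rtranclp[where r = ?R, OF R(2) IH(2)] by (rule conjI)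
  qed simp
  fix a b assume "a \<in> arc m x y" "b \<in> arc m x y"
  then obtain i j where ij: "x \<le> i" "i < y" "a = good_at m i" "x \<le> j" "j < y" "b = good_at m j"
    by (auto simp: arc_def)
  show "?R\<^sup>*\<^sup>* a b"
  proof (cases "i \<le> j")
    case True
    then show ?thesis using path[of i "nat (j - i)"] ij by simp
  next
    case False
    then show ?thesis using path[of j "nat (i - j)"] ij by simp
  qed
qed

text \<open>Unroll the cycle at a missing good and take the maximal run of \<open>S\<close> around
  one of its goods. An adjacency step within \<open>S\<close> cannot leave the run, so by
  connectivity the run is all of \<open>S\<close>. A whole number of turns moves its start into one
  fixed turn.\<close>

lemma arc_bundle:
  assumes m: "m > 0" and b: "is_bundle m S" and "S \<noteq> {}"
  obtains x y where "0 \<le> x" "x < int m" "x < y" "y \<le> x + int m" "S = arc m x y"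
proof (cases "S = {..<m}")
  case True
  then show ?thesis using that[of 0 "int m"] m arc_full[OF m, of 0] by simp
next
  case False
  have sub: "S \<subseteq> {..<m}" and conn: "\<And>a c. a \<in> S \<Longrightarrow> c \<in> S \<Longrightarrow>
      (\<lambda>a b. a \<in> S \<and> b \<in> S \<and> cycle_adj m a b)\<^sup>*\<^sup>* a c"
    using b unfolding is_bundle_def by auto
  obtain g where g: "g < m" "g \<notin> S" using False sub by auto
  obtain s where s: "s \<in> S" using \<open>S \<noteq> {}\<close> by auto
  then have "s \<in> arc m (int g) (int g + int m)" unfolding arc_full[OF m] using sub by auto
  then obtain c where c: "int g \<le> c" "c < int g + int m" "good_at m c = s" by (auto simp: arc_def)
  define A where "A = {int g..c} \<inter> {j. good_at m j \<notin> S}"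
  define B where "B = {c..int g + int m} \<inter> {j. good_at m j \<notin> S}"
  have A: "finite A" "int g \<in> A" and B: "finite B" "int g + int m \<in> B"
    using g c by (auto simp: A_def B_def)
  have "Max A \<in> A" "Min B \<in> B" using A B by (intro Max_in Min_in; auto)+
  then obtain a y where MA: "a \<in> A" "\<And>j. j \<in> A \<Longrightarrow> j \<le> a" and MB: "y \<in> B" "\<And>j. j \<in> B \<Longrightarrow> y \<le> j"
    using Max_ge[OF A(1)] Min_le[OF B(1)] by blast
  define x where "x = a + 1"
  have xc: "x \<le> c" "c < y" "int g < x" "y \<le> int g + int m"
  proof -
    have "a \<noteq> c" "y \<noteq> c" using MA(1) MB(1) s c(3) by (auto simp: A_def B_def)
    then show "x \<le> c" "c < y" using MA(1) MB(1) by (auto simp: A_def B_def x_def)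
    show "int g < x" "y \<le> int g + int m" using MA(1) MB(1) by (auto simp: A_def B_def x_def)
  qed
  have ends: "good_at m (x - 1) \<notin> S" "good_at m y \<notin> S" using MA(1) MB(1) by (auto simp: A_def B_def x_def)
  have inS: "good_at m j \<in> S" if "x \<le> j" "j < y" for j
  proof (rule ccontr)
    assume n: "good_at m j \<notin> S"
    show False
    proof (cases "j \<le> c")
      case True
      then have "j \<in> A" using n that xc by (auto simp: A_def)
      then show False using MA(2)[of j] that(1) by (simp add: x_def)
    next
      case False
      then have "j \<in> B" using n that xc by (auto simp: B_def)
      then show False using MB(2)[of j] that(2) by simp
    qed
  qed
  have "d \<in> arc m x y" if "(\<lambda>a b. a \<in> S \<and> b \<in> S \<and> cycle_adj m a b)\<^sup>*\<^sup>* s d" for d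
    using that
  proof induction
    case base
    then show ?case using c(3) xc by (auto simp: arc_def)
  next
    case (step a d)
    then obtain j where j: "x \<le> j" "j < y" "a = good_at m j" by (auto simp: arc_def)
    have d: "d \<in> S" "d < m" using step sub by auto
    consider "d = Suc a mod m" | "a = Suc d mod m" using step by (auto simp: cycle_adj_def)
    then show ?case
    proof cases
      case 1
      then have "d = good_at m (j + 1)" using good_at_Suc[OF m] j by simp
      then have "j + 1 \<noteq> y" using d ends by auto
      then show ?thesis using j \<open>d = good_at m (j + 1)\<close> unfolding arc_def by (intro image_eqI[of _ _ "j + 1"]) auto
    next
      \<comment> \<open>For a step backwards, \<open>d\<close> is looked up among the
        \<open>m\<close> positions before \<open>j\<close>; injectivity within one turn identifies
        its position as \<open>j - 1\<close>.\<close>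
      case 2
      have "d \<in> arc m (j - int m) (j - int m + int m)" unfolding arc_full[OF m] using d(2) by simp
      then obtain i where i: "j - int m \<le> i" "i < j" "d = good_at m i" by (auto simp: arc_def)
      have "good_at m (i + 1) = good_at m j" using 2 good_at_Suc[OF m, of i] i j by simp
      then have "i = j - 1" using good_at_inj[OF m, of "i + 1" j] i by simp
      then have "j \<noteq> x" using d ends i by auto
      then show ?thesis using j i \<open>i = j - 1\<close> unfolding arc_def by (intro image_eqI[of _ _ "j - 1"]) auto
    qed
  qed
  then have "S = arc m x y" using conn[OF s] inS by (auto simp: arc_def)
  moreover have e: "x = x mod int m + int m * (x div int m)" by simp
  moreover have "y = (y - int m * (x div int m)) + int m * (x div int m)" by simp
  ultimately have "S = arc m (x mod int m) (y - int m * (x div int m))" using arc_shift by metis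
  then show ?thesis using that[of "x mod int m" "y - int m * (x div int m)"] m xc e by force
qed

text \<open>The sorted starting points of the pieces, repeated every turn, are the cuts. Non-empty
  disjoint pieces have distinct starts, so there are exactly \<open>n\<close> per turn, and no piece
  reaches beyond the next start.\<close>

lemma split_cuts:
  assumes m: "m > 0" and n: "n > 0" and P: "is_split m n P" and ne: "\<And>i. i < n \<Longrightarrow> P i \<noteq> {}"
  shows "\<exists>c. (\<forall>k. c (k + int n) = c k + int m) \<and>
    (\<forall>k. \<exists>i<n. \<exists>y. c k \<le> y \<and> y \<le> c k + int m \<and> y \<le> c (k + 1) \<and> P i = arc m (c k) y)"
proof -
  have "\<exists>x y. 0 \<le> x \<and> x < int m \<and> x < y \<and> y \<le> x + int m \<and> P i = arc m x y" if "i < n" for i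
    using arc_bundle[OF m, of "P i"] P ne[OF that] that unfolding is_split_def by metis
  then obtain x y where xy: "\<And>i. i < n \<Longrightarrow> 0 \<le> x i" "\<And>i. i < n \<Longrightarrow> x i < int m" "\<And>i. i < n \<Longrightarrow> x i < y i"
    "\<And>i. i < n \<Longrightarrow> y i \<le> x i + int m" "\<And>i. i < n \<Longrightarrow> P i = arc m (x i) (y i)" by metis
  have disj: "i = j" if "i < n" "j < n" "x i \<le> x j + int m * q" "x j + int m * q < y i" for i j q
  proof (rule ccontr)
    assume "i \<noteq> j"
    then have "P i \<inter> P j = {}" using P that unfolding is_split_def by blast
    moreover have "good_at m (x j + int m * q) \<in> P i"
      unfolding xy(5)[OF that(1)] arc_def by (rule imageI) (use that in simp)
    moreover have "good_at m (x j) \<in> P j"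
      unfolding xy(5)[OF that(2)] arc_def by (rule imageI) (use xy(3)[OF that(2)] in simp)
    ultimately show False by auto
  qed
  have inj: "inj_on x {..<n}" using disj[of _ _ 0] xy(3) by (intro inj_onI) force
  define L where "L = sorted_list_of_set (x ` {..<n})"
  have L: "length L = n" "sorted_wrt (<) L" "set L = x ` {..<n}"
    using inj by (simp_all add: L_def card_image strict_sorted_list_of_set)
  define c where "c k = L ! nat (k mod int n) + int m * (k div int n)" for k
  show ?thesis
  proof (intro exI[of _ c] conjI allI)
    show "c (k + int n) = c k + int m" for k using n by (simp add: c_def algebra_simps)
    fix k
    define r where "r = nat (k mod int n)"
    have r: "r < n" "int r = k mod int n" using n by (simp_all add: r_def nat_less_iff)
    have "L ! r \<in> x ` {..<n}" using r L(1) nth_mem[of r L] unfolding L(3)[symmetric] by simp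
    then obtain i where i: "i < n" "L ! r = x i" by auto
    have ck: "c k = x i + int m * (k div int n)" using i by (simp add: c_def r_def)
    have yc: "y i + int m * (k div int n) \<le> c (k + 1)"
    proof (cases "Suc r < n")
      case True
      have "L ! Suc r \<in> x ` {..<n}" using True L(1) nth_mem[of "Suc r" L] unfolding L(3)[symmetric] by simp
      then obtain j where j: "j < n" "L ! Suc r = x j" by auto
      have "(k + 1) mod int n = int (Suc r)" "(k + 1) div int n = k div int n"
      proof -
        have k1: "k + 1 = int (Suc r) + int n * (k div int n)" using r(2) by simp
        have "0 \<le> int (Suc r)" "int (Suc r) < int n" using True by auto
        then show "(k + 1) mod int n = int (Suc r)" "(k + 1) div int n = k div int n"
          unfolding k1 by (simp_all only: mod_mult_self2 mod_pos_pos_trivial) simp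
      qed
      then have c1: "c (k + 1) = x j + int m * (k div int n)" using j by (simp only: c_def nat_int)
      have "x i < x j" using sorted_wrt_nth_less[OF L(2), of r "Suc r"] True L(1) i j by simp
      then have "\<not> x j < y i" using disj[of i j 0] i j by auto
      then show ?thesis using c1 by simp
    next
      case False
      then have rn: "r = n - 1" using r by simp
      have "L ! 0 \<in> x ` {..<n}" using n L(1) nth_mem[of 0 L] unfolding L(3)[symmetric] by simp
      then obtain j where j: "j < n" "L ! 0 = x j" by auto
      have "k mod int n = int n - 1" using r(2) rn n by simp
      then have "k + 1 = int n * (k div int n) + int n" using mult_div_mod_eq[of "int n" k] by linarith
      then have "k + 1 = int n * (k div int n + 1)" by (simp add: distrib_left)
      then have "(k + 1) mod int n = 0" "(k + 1) div int n = k div int n + 1" using n by simp_all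
      then have c1: "c (k + 1) = x j + int m * (k div int n + 1)" using j by (simp add: c_def)
      \<comment> \<open>Wrap-around: the next start is that of the first piece one turn later. An
        overlap forces \<open>i = j\<close>, the case of a single piece, where the bound on the
        length of an arc decides.\<close>
      have "y i \<le> x j + int m"
      proof (rule ccontr)
        assume nle: "\<not> ?thesis"
        then have "i = j" using disj[of i j 1] xy(1,2) i j by force
        then show False using nle xy(4) i by auto
      qed
      then show ?thesis using c1 by (simp add: algebra_simps)
    qed
    show "\<exists>i<n. \<exists>y. c k \<le> y \<and> y \<le> c k + int m \<and> y \<le> c (k + 1) \<and> P i = arc m (c k) y"
      using i yc ck xy(3,4,5)[OF i(1)] arc_shift[of m "x i" "k div int n" "y i"]
      by (intro exI[of _ i] exI[of _ "y i + int m * (k div int n)"] conjI) auto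
  qed
qed

section \<open>Prefix sums and the main theorem\<close>

text \<open>The sign for negative positions makes every difference a sum over an interval, on the
  whole unrolled cycle.\<close>

definition prefix :: "(int \<Rightarrow> real) \<Rightarrow> int \<Rightarrow> real" where
  "prefix w x = (if x \<ge> 0 then sum w {0..<x} else - sum w {x..<0})"

lemma prefix_step: "prefix w (x + 1) = prefix w x + w x"
proof (cases "x \<ge> 0")
  case True
  then have "{0..<x + 1} = insert x {0..<x}" by auto
  then show ?thesis using True by (simp add: prefix_def)
next
  case False
  then have "{x..<0} = insert x {x + 1..<0}" by auto
  then show ?thesis using False by (cases "x = - 1") (simp_all add: prefix_def)
qed

lemma prefix_diff: "x \<le> y \<Longrightarrow> prefix w y = prefix w x + sum w {x..<y}"
proof (induction y rule: int_ge_induct)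
  case (step y)
  then have "{x..<y + 1} = insert y {x..<y}" by auto
  then show ?case using step by (simp add: prefix_step)
qed simp

lemma prefix_mono: "(\<And>k. w k \<ge> 0) \<Longrightarrow> mono (prefix w)"
  by (rule monoI) (simp add: prefix_diff sum_nonneg)

lemma prefix_period:
  assumes "\<And>k. w (k + m) = w k"
  shows "prefix w (x + m) - prefix w x = prefix w (y + m) - prefix w y"
proof -
  have "prefix w (x + m) - prefix w x = prefix w (0 + m) - prefix w 0" for x
  proof (induction x rule: int_induct[where k = 0])
    case (step1 i)
    then show ?case using prefix_step[of w "i + m"] prefix_step[of w i] assms[of i] by (simp add: algebra_simps)
  next
    case (step2 i)
    then show ?case using prefix_step[of w "i - 1 + m"] prefix_step[of w "i - 1"] assms[of "i - 1"]
      by (simp add: algebra_simps)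
  qed simp
  from this[of x] this[of y] show ?thesis by simp
qed

lemma util_arc:
  assumes "m > 0" "x \<le> y" "y \<le> x + int m"
  shows "util v (arc m x y) = prefix (\<lambda>k. v (good_at m k)) y - prefix (\<lambda>k. v (good_at m k)) x"
proof -
  have "inj_on (good_at m) {x..<y}" using good_at_inj[OF assms(1)] assms(3) by (intro inj_onI) auto
  then show ?thesis unfolding util_def arc_def prefix_diff[OF assms(2)] by (simp add: sum.reindex)
qed

text \<open>The explicit form, with the served types as a list, allows the pieces to be permuted
  among the agents later.\<close>

lemma deals_list:
  assumes "deals F e N p"
  shows "\<exists>ts q. q 0 = p \<and> q (length ts) \<le> e \<and> (\<forall>t. count_list ts t = N t) \<and>
    (\<forall>j<length ts. q j \<le> q (Suc j) \<and> F (ts ! j) (q j) + 3/4 \<le> F (ts ! j) (q (Suc j)))"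
  using assms
proof induction
  case (finish N p)
  then show ?case by (intro exI[of _ "[]"] exI[of _ "\<lambda>_. p"]) simp
next
  case (serve N t p p')
  then obtain ts q where q: "q 0 = p'" "q (length ts) \<le> e" "\<And>x. count_list ts x = (N(t := N t - 1)) x"
    "\<And>j. j < length ts \<Longrightarrow> q j \<le> q (Suc j) \<and> F (ts ! j) (q j) + 3/4 \<le> F (ts ! j) (q (Suc j))"
    by blast
  have "case_nat p q j \<le> q j \<and> F ((t # ts) ! j) (case_nat p q j) + 3/4 \<le> F ((t # ts) ! j) (q j)"
    if "j < Suc (length ts)" for j
    using that q(1,4) serve(2,3) by (cases j) auto
  moreover have "count_list (t # ts) x = N x" for x using q(3)[of x] serve(1) by auto
  ultimately show ?case using q(2)
    by (intro exI[of _ "t # ts"] exI[of _ "case_nat p q"]) simp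
qed

section \<open>From maximin shares to cuts and from cuts to splits\<close>

lemma trivial_split:
  assumes "m > 0" "n > 0"
  shows "is_split m n (\<lambda>i. if i = 0 then {..<m} else {})"
  using assms bundle_arc[of m 0 "int m"] arc_full[of m 0] by (auto simp: is_split_def is_bundle_def split: if_splits)

lemma mms_attained:
  assumes "m > 0" "n > 0"
  obtains P where "is_split m n P" "\<And>i. i < n \<Longrightarrow> mms m n u \<le> util u (P i)"
proof -
  let ?S = "{Min ((\<lambda>i. util u (P i)) ` {..<n}) | P. is_split m n P}"
  \<comment> \<open>Infinitely many functions \<open>P\<close> agree on the indices below
    \<open>n\<close>, so finiteness is read off from the minima themselves, which are utilities of
    sets of goods.\<close>
  have "?S \<subseteq> util u ` Pow {..<m}"
  proof
    fix s assume "s \<in> ?S"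
    then obtain P where P: "is_split m n P" "s = Min ((\<lambda>i. util u (P i)) ` {..<n})" by auto
    have "s \<in> (\<lambda>i. util u (P i)) ` {..<n}" unfolding P(2) using assms(2) by (intro Min_in) auto
    then show "s \<in> util u ` Pow {..<m}" using P(1) unfolding is_split_def is_bundle_def by auto
  qed
  then have "finite ?S" by (rule finite_subset) simp
  moreover have "?S \<noteq> {}" using trivial_split[OF assms] by blast
  ultimately have "mms m n u \<in> ?S" unfolding mms_def by (rule Max_in)
  then obtain P where P: "is_split m n P" "mms m n u = Min ((\<lambda>i. util u (P i)) ` {..<n})" by auto
  show ?thesis by (rule that[OF P(1)]) (simp add: P(2))
qed

text \<open>A positive maximin share makes every piece of an optimal split non-empty, so
  \<open>split_cuts\<close> applies. Each piece ends by the next cut, and monotonicity transfers its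
  value to the whole arc.\<close>

lemma mms_cuts:
  assumes m: "m > 0" and n: "n > 0" and M: "mms m n u > 0" and u: "\<And>g. g < m \<Longrightarrow> u g \<ge> 0"
  shows "\<exists>c. (\<forall>k. c (k + int n) = c k + int m) \<and>
    (\<forall>k. prefix (\<lambda>k. u (good_at m k) / mms m n u) (c k) + 1
      \<le> prefix (\<lambda>k. u (good_at m k) / mms m n u) (c (k + 1)))"
proof -
  let ?v = "\<lambda>g. u g / mms m n u"
  obtain P where P: "is_split m n P" "\<And>i. i < n \<Longrightarrow> mms m n u \<le> util u (P i)"
    by (rule mms_attained[OF m n, of u]) blast
  have ne: "P i \<noteq> {}" if "i < n" for i using P(2)[OF that] M by (auto simp: util_def)
  obtain c where c: "\<And>k. c (k + int n) = c k + int m"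
    "\<And>k. \<exists>i<n. \<exists>y. c k \<le> y \<and> y \<le> c k + int m \<and> y \<le> c (k + 1) \<and> P i = arc m (c k) y"
    using split_cuts[OF m n P(1) ne] by metis
  have mono: "mono (prefix (\<lambda>k. ?v (good_at m k)))"
    using u good_at_less[OF m] M by (intro prefix_mono) simp
  show ?thesis
  proof (intro exI[of _ c] conjI allI)
    fix k
    obtain i y where iy: "i < n" "c k \<le> y" "y \<le> c k + int m" "y \<le> c (k + 1)" "P i = arc m (c k) y"
      using c(2)[of k] by blast
    have "util ?v (P i) = util u (P i) / mms m n u" by (simp add: util_def sum_divide_distrib)
    then have "1 \<le> util ?v (P i)" using P(2)[OF iy(1)] M by simp
    moreover have "prefix (\<lambda>k. ?v (good_at m k)) y \<le> prefix (\<lambda>k. ?v (good_at m k)) (c (k + 1))"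
      by (rule monoD[OF mono iy(4)])
    ultimately show "prefix (\<lambda>k. ?v (good_at m k)) (c k) + 1 \<le> prefix (\<lambda>k. ?v (good_at m k)) (c (k + 1))"
      unfolding iy(5) util_arc[OF m iy(2,3)] by linarith
  qed (rule c(1))
qed

lemma split_of_cuts:
  assumes m: "m > 0" and q: "\<And>j. j < n \<Longrightarrow> q j \<le> q (Suc j)" "q n = q 0 + int m"
    and perm: "\<pi> permutes {..<n}"
  shows "is_split m n (\<lambda>i. arc m (q (\<pi> i)) (q (Suc (\<pi> i))))"
proof -
  have mono: "q i \<le> q j" if "i \<le> j" "j \<le> n" for i j
    using that
  proof (induction j rule: dec_induct)
    case (step j)
    then show ?case using q(1)[of j] by simp
  qed simp
  have pi: "\<pi> i < n" if "i < n" for i using permutes_in_image[OF perm] that by auto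
  have disj: "arc m (q i) (q (Suc i)) \<inter> arc m (q j) (q (Suc j)) = {}" if "i < j" "j < n" for i j
  proof (rule ccontr)
    assume "\<not> ?thesis"
    then obtain a b where ab: "q i \<le> a" "a < q (Suc i)" "q j \<le> b" "b < q (Suc j)" "good_at m a = good_at m b"
      by (auto simp: arc_def)
    have "q 0 \<le> q i" "q (Suc i) \<le> q j" "q (Suc j) \<le> q n" using that by (intro mono; simp)+
    then have "a < b" "b - a < int m" using ab q(2) by linarith+
    then show False using good_at_inj[OF m ab(5)] by simp
  qed
  have cover: "{q 0..<q k} \<subseteq> (\<Union>j<k. {q j..<q (Suc j)})" for k
    by (induction k) (auto simp: lessThan_Suc not_less)
  show ?thesis
    unfolding is_split_def
  proof (intro conjI allI impI)
    show "is_bundle m (arc m (q (\<pi> i)) (q (Suc (\<pi> i))))" for i by (rule bundle_arc[OF m])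
    fix i j assume ij: "i < n" "j < n" "i \<noteq> j"
    then have "\<pi> i \<noteq> \<pi> j" using permutes_inj[OF perm] by (auto dest: injD)
    then show "arc m (q (\<pi> i)) (q (Suc (\<pi> i))) \<inter> arc m (q (\<pi> j)) (q (Suc (\<pi> j))) = {}"
      using disj[of "\<pi> i" "\<pi> j"] disj[of "\<pi> j" "\<pi> i"] pi ij by (metis Int_commute linorder_neqE_nat)
  next
    have "(\<Union>i<n. arc m (q (\<pi> i)) (q (Suc (\<pi> i)))) = (\<Union>j\<in>\<pi> ` {..<n}. arc m (q j) (q (Suc j)))" by simp
    also have "\<dots> = (\<Union>j<n. arc m (q j) (q (Suc j)))" by (simp only: permutes_image[OF perm])
    also have "\<dots> = {..<m}"
    proof
      show "(\<Union>j<n. arc m (q j) (q (Suc j))) \<subseteq> {..<m}" using good_at_less[OF m] by (auto simp: arc_def)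
      have "{..<m} = good_at m ` {q 0..<q n}" using arc_full[OF m, of "q 0"] q(2) by (simp add: arc_def)
      also have "\<dots> \<subseteq> (\<Union>j<n. arc m (q j) (q (Suc j)))" using cover[of n] unfolding arc_def by blast
      finally show "{..<m} \<subseteq> (\<Union>j<n. arc m (q j) (q (Suc j)))" .
    qed
    finally show "(\<Union>i<n. arc m (q (\<pi> i)) (q (Suc (\<pi> i)))) = {..<m}" .
  qed
qed

text \<open>A type with exactly three elements, as \<open>trio\<close> demands of its universe;
  kinds without agents get the count 0.\<close>

datatype kind = First | Second | Third

lemma UNIV_kind: "UNIV = {First, Second, Third}"
  using kind.exhaust by auto

instance kind :: finite
  by standard (simp add: UNIV_kind)

primrec index :: "kind \<Rightarrow> nat" where
  "index First = 0" | "index Second = 1" | "index Third = 2"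

definition kind_of :: "nat \<Rightarrow> kind" where
  "kind_of t = (if t = 0 then First else if t = 1 then Second else Third)"

lemma index_kind_of: "t < 3 \<Longrightarrow> index (kind_of t) = t"
  by (auto simp: kind_of_def)

lemma index_less: "index x < 3"
  by (cases x) auto

theorem theorem4p9:
  fixes m n :: nat and u :: "nat \<Rightarrow> nat \<Rightarrow> real" and \<tau> :: "nat \<Rightarrow> nat"
  assumes "m \<ge> 3" and "n \<ge> 1"
    and "\<And>t g. t < 3 \<Longrightarrow> g < m \<Longrightarrow> u t g \<ge> 0"
    and "\<And>i. i < n \<Longrightarrow> \<tau> i < 3"
  shows "\<exists>P. sufficient (3/4) m n (\<lambda>i. u (\<tau> i)) P"
proof (cases "\<exists>t<3. mms m n (u t) > 0")
  case False
  have "0 \<le> util (u (\<tau> i)) S" if "i < n" "S \<subseteq> {..<m}" for i S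
    unfolding util_def using that assms(3)[OF assms(4)[OF that(1)]] by (intro sum_nonneg) auto
  moreover have "mms m n (u (\<tau> i)) \<le> 0" if "i < n" for i using False assms(4)[OF that] by (meson not_less)
  moreover have "is_split m n (\<lambda>i. if i = 0 then {..<m} else {})" using assms by (intro trivial_split) auto
  ultimately show ?thesis
    unfolding sufficient_def
    by (intro exI[of _ "\<lambda>i. if i = 0 then {..<m} else {}"]) (force intro: order_trans[of _ 0])
next
  case True
  then obtain t0 where t0: "t0 < 3" "mms m n (u t0) > 0" by blast
  have mn: "m > 0" "n > 0" using assms(1,2) by auto
  \<comment> \<open>a type whose maximin share is not positive accepts any bundle, so it may borrow the utility of \<open>t0\<close>\<close>
  define src where "src t = (if mms m n (u t) > 0 then t else t0)" for t
  have src: "src t < 3" "mms m n (u (src t)) > 0" if "t < 3" for t using that t0 by (auto simp: src_def)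
  define v where "v x g = u (src (index x)) g / mms m n (u (src (index x)))" for x g
  define F where "F x = prefix (\<lambda>k. v x (good_at m k))" for x
  have nonneg: "v x g \<ge> 0" if "g < m" for x g
    using assms(3)[OF src(1)[OF index_less] that, of x] src(2)[OF index_less, of x]
    unfolding v_def by (intro divide_nonneg_pos)
  have "\<exists>c. (\<forall>k. c (k + int n) = c k + int m) \<and> (\<forall>k. F x (c k) + 1 \<le> F x (c (k + 1)))" for x
    unfolding F_def v_def
    by (rule mms_cuts[OF mn src(2)[OF index_less] assms(3)[OF src(1)[OF index_less]]])
  then obtain cut where cut: "\<And>x k. cut x (k + int n) = cut x k + int m"
    "\<And>x k. F x (cut x k) + 1 \<le> F x (cut x (k + 1))" by metis
  define ks where "ks = map (\<lambda>i. kind_of (\<tau> i)) [0..<n]"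
  interpret cake F cut "int m" n "count_list ks"
  proof
    show "mono (F x)" for x unfolding F_def using nonneg good_at_less[OF mn(1)] by (intro prefix_mono) simp
    show "F t (x + int m) - F t x = F t (y + int m) - F t y" for t x y
      unfolding F_def by (rule prefix_period) simp
    show "sum (count_list ks) UNIV = n" using sum_count_set[of ks UNIV] by (simp add: ks_def)
  qed (use cut mn in auto)
  have "trio First Second Third" by (simp add: trio_def UNIV_kind)
  then obtain p where "deals F (p + int m) (count_list ks) p" using deals_exists by blast
  from deals_list[OF this] obtain ts q where q: "q 0 = p" "q (length ts) \<le> p + int m"
    "\<And>t. count_list ts t = count_list ks t"
    "\<And>j. j < length ts \<Longrightarrow> q j \<le> q (Suc j) \<and> F (ts ! j) (q j) + 3/4 \<le> F (ts ! j) (q (Suc j))"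
    by blast
  \<comment> \<open>\<open>deals\<close> fixes only how many pieces each type receives. Equality of
    the multisets yields the permutation that gives agent \<open>i\<close> the piece number
    \<open>\<pi> i\<close>.\<close>
  have "mset ks = mset ts" by (rule multiset_eqI) (simp add: count_mset q(3))
  then obtain \<pi> where \<pi>: "\<pi> permutes {..<length ts}" "permute_list \<pi> ts = ks" by (rule mset_eq_permutation)
  have len: "length ts = n" using \<open>mset ks = mset ts\<close> mset_eq_length[of ks ts] by (simp add: ks_def)
  \<comment> \<open>The cutting may end before the turn is complete; the last piece is extended to
    \<open>p + int m\<close>, so that all goods are allocated.\<close>
  define r where "r j = (if j = n then p + int m else q j)" for j
  have r: "r j \<le> r (Suc j)" if "j < n" for j
    using q(2) q(4)[of j] that len by (auto simp: r_def)
  have r': "F (ts ! j) (r j) + 3/4 \<le> F (ts ! j) (r (Suc j))" if "j < n" for j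
    using q(4)[of j] that len le_F[of "q (Suc j)" "p + int m" "ts ! j"] q(2) by (auto simp: r_def)
  have rn: "r n = r 0 + int m" using q(1) mn by (simp add: r_def)
  have r_mono: "r i \<le> r j" if "i \<le> j" "j \<le> n" for i j
    using that
  proof (induction j rule: dec_induct)
    case (step j)
    then show ?case using r[of j] by simp
  qed simp
  define P where "P i = arc m (r (\<pi> i)) (r (Suc (\<pi> i)))" for i
  have split: "is_split m n P"
    unfolding P_def using mn(1) r rn \<pi>(1) unfolding len by (rule split_of_cuts)
  have "3/4 * mms m n (u (\<tau> i)) \<le> util (u (\<tau> i)) (P i)" if i: "i < n" for i
  proof (cases "mms m n (u (\<tau> i)) > 0")
    case False
    have "0 \<le> util (u (\<tau> i)) (P i)"
      unfolding util_def using split i assms(3)[OF assms(4)[OF i]]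
      by (intro sum_nonneg) (auto simp: is_split_def is_bundle_def)
    then show ?thesis using False by simp
  next
    case True
    have j: "\<pi> i < n" using permutes_in_image[OF \<pi>(1), of i] i len by simp
    have "ts ! \<pi> i = ks ! i" using permute_list_nth[OF \<pi>(1), of i] i len \<pi>(2) by simp
    then have ti: "index (ts ! \<pi> i) = \<tau> i" using i index_kind_of[OF assms(4)[OF i]] by (simp add: ks_def)
    have "r (Suc (\<pi> i)) \<le> r (\<pi> i) + int m" using r_mono[of 0 "\<pi> i"] r_mono[of "Suc (\<pi> i)" n] rn j by simp
    then have "util (v (ts ! \<pi> i)) (P i) = F (ts ! \<pi> i) (r (Suc (\<pi> i))) - F (ts ! \<pi> i) (r (\<pi> i))"
      unfolding P_def F_def using r[OF j] mn(1) by (intro util_arc)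
    then have "3/4 \<le> util (v (ts ! \<pi> i)) (P i)" using r'[OF j] by simp
    \<comment> \<open>The share of this agent is positive, so \<open>src\<close> returns the type
      itself and \<open>v\<close> is its own scaled utility.\<close>
    also have "util (v (ts ! \<pi> i)) (P i) = util (u (\<tau> i)) (P i) / mms m n (u (\<tau> i))"
      using True by (simp add: util_def v_def ti src_def sum_divide_distrib)
    finally show ?thesis using True by (simp add: field_simps)
  qed
  then show ?thesis using split unfolding sufficient_def by blast
qed

end
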